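(* Let $L=(L_t)_{t\ge0}$ be a real-valued Lévy process without Gaussian component whose drift, whenever it exists, is equal to zero. Assume that there is a continuous increasing function $f:[0,\infty)\to[0,\infty)$ that is regularly varying with index $a\in(0,1/2]$ at zero such that $f(t)^{-1}L_t\to v$ in probability as $t\downarrow0$ for some finite value $v\in\mathbb{R}$. Let $\sigma:\mathbb{R}\to\mathbb{R}$ be twice continuously differentiable and at most of linear growth, let $x\in\mathbb{R}$, and let $X=(X_t)_{t\ge0}$ be the solution of the stochastic differential equation $\mathrm{d}X_t=\sigma(X_{t-})\,\mathrm{d}L_t$, $X_0=x$. Then $$\frac{X_t-x}{f(t)}\to\sigma(x)v\quad\text{in probability as } t\downarrow0.$$
   Context: Work on a filtered probability space $(\Omega,\mathcal{F},(\mathcal{F}_t)_{t\ge0},P)$ satisfying the usual hypotheses (complete and right-continuous filtration); all processes are adapted to it, and Lévy processes (stationary independent increments, a.s. càdlàg paths, $L_0=0$ a.s.) are in particular semimartingales with respect to it. Let $(A_L,\nu_L,\gamma_L)$ be the characteristic triplet of $L$ with respect to the truncation function $s\mathbf{1}_{\{|s|\le1\}}$. "Without Gaussian component" means $A_L=0$. The drift of $L$ exists if $\int_{[-1,1]}|s|\,\nu_L(\mathrm{d}s)<\infty$, in which case it equals $\gamma_L-\int_{[-1,1]}s\,\nu_L(\mathrm{d}s)$. Regularly varying with index $a$ at zero means $f(\lambda t)/f(t)\to\lambda^a$ as $t\downarrow0$ for every $\lambda>0$. At most of linear growth means that there is a constant $C$ with $|\sigma(y)|\le C(1+|y|)$ for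 all $y$. The solution of the SDE is the unique strong solution, i.e. the semimartingale with $X_t=x+\int_{0+}^t\sigma(X_{s-})\,\mathrm{d}L_s$ for all $t\ge0$, where $\int_{0+}^t$ denotes the stochastic integral over $(0,t]$. *)

theory Defs
  imports "HOL-Probability.Probability"
begin

section \<open>Filtered probability spaces and processes\<close>

text \<open>
  Processes are functions \<open>real \<Rightarrow> 'a \<Rightarrow> real\<close> of which only the values at
  times \<open>t \<ge> 0\<close> matter. The library's filtrations are indexed by a whole linear order, here
  \<open>real\<close>; a filtration on \<open>[0,\<infinity>)\<close> is extended, for instance, by \<open>F t = F 0\<close> for \<open>t < 0\<close>.
  A stopping time \<open>T \<ge> 0\<close> and its \<open>\<sigma>\<close>-algebra only depend on \<open>F t\<close> for \<open>t \<ge> 0\<close>, because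
  \<open>{T \<le> t}\<close> is empty for \<open>t < 0\<close>.
\<close>

locale filtered_prob_space =
  prob_space M + complete_measure M + filtration "space M" F
  for M :: "'a measure" and F :: "real \<Rightarrow> 'a measure" +
  assumes subalgebra_F: "\<And>t. t \<ge> 0 \<Longrightarrow> subalgebra M (F t)"
    and null_sets_F: "null_sets M \<subseteq> sets (F 0)"
    and right_continuous_F: "\<And>t. t \<ge> 0 \<Longrightarrow> sets (F t) = (\<Inter>s\<in>{t<..}. sets (F s))"

definition adapted :: "(real \<Rightarrow> 'a measure) \<Rightarrow> (real \<Rightarrow> 'a \<Rightarrow> real) \<Rightarrow> bool" where
  "adapted F X \<longleftrightarrow> (\<forall>t\<ge>0. X t \<in> borel_measurable (F t))"

definition cadlag :: "(real \<Rightarrow> real) \<Rightarrow> bool" where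
  "cadlag g \<longleftrightarrow> (\<forall>t\<ge>0. continuous (at_right t) g) \<and> (\<forall>t>0. \<exists>l. (g \<longlongrightarrow> l) (at_left t))"

definition caglad :: "(real \<Rightarrow> real) \<Rightarrow> bool" where
  "caglad g \<longleftrightarrow> (\<forall>t>0. continuous (at_left t) g) \<and> (\<forall>t\<ge>0. \<exists>l. (g \<longlongrightarrow> l) (at_right t))"

text \<open>The value at time 0 is a convention without influence on integrals over \<open>(0,t]\<close>.\<close>

definition left_limit :: "(real \<Rightarrow> 'a \<Rightarrow> real) \<Rightarrow> real \<Rightarrow> 'a \<Rightarrow> real" where
  "left_limit X t \<omega> = (if t \<le> 0 then X 0 \<omega> else Lim (at_left t) (\<lambda>s. X s \<omega>))"

definition tendsto_in_prob ::
    "'a measure \<Rightarrow> ('i \<Rightarrow> 'a \<Rightarrow> real) \<Rightarrow> ('a \<Rightarrow> real) \<Rightarrow> 'i filter \<Rightarrow> bool" where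
  "tendsto_in_prob M Y Z G \<longleftrightarrow>
     (\<forall>\<epsilon>>0. ((\<lambda>i. measure M {\<omega> \<in> space M. \<epsilon> < \<bar>Y i \<omega> - Z \<omega>\<bar>}) \<longlongrightarrow> 0) G)"

text \<open>
  Uniform convergence on compact time intervals in probability. It is used below only for
  processes which almost surely have one-sided continuous paths, so that on a complete space the
  events are measurable.
\<close>

definition ucp_tendsto ::
    "'a measure \<Rightarrow> (nat \<Rightarrow> real \<Rightarrow> 'a \<Rightarrow> real) \<Rightarrow> (real \<Rightarrow> 'a \<Rightarrow> real) \<Rightarrow> bool" where
  "ucp_tendsto M Y Z \<longleftrightarrow> (\<forall>t\<ge>0. \<forall>\<epsilon>>0.
     (\<lambda>k. measure M {\<omega> \<in> space M. \<exists>s\<in>{0..t}. \<epsilon> < \<bar>Y k s \<omega> - Z s \<omega>\<bar>}) \<longlonglongrightarrow> 0)"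


section \<open>Stochastic integration\<close>

text \<open>
  The construction follows Protter (Stochastic Integration and Differential Equations, Chapter II).
  An element of the following type represents the simple predictable process
  \<open>init \<cdot> 1\<^bsub>{0}\<^esub> + (\<Sum>i<len. coef i \<cdot> 1\<^bsub>(time i, time (i+1)]\<^esub>)\<close>.
\<close>

datatype 'a simple_process = Simple_Process
  (len: nat) (time: "nat \<Rightarrow> 'a \<Rightarrow> real") (init: "'a \<Rightarrow> real") (coef: "nat \<Rightarrow> 'a \<Rightarrow> real")

definition simple_predictable ::
    "'a measure \<Rightarrow> (real \<Rightarrow> 'a measure) \<Rightarrow> 'a simple_process \<Rightarrow> bool" where
  "simple_predictable M F S \<longleftrightarrow>
     (\<forall>\<omega>\<in>space M. time S 0 \<omega> = 0) \<and>
     (\<forall>i<len S. \<forall>\<omega>\<in>space M. time S i \<omega> \<le> time S (Suc i) \<omega>) \<and>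
     (\<forall>i\<le>len S. stopping_time F (time S i)) \<and>
     init S \<in> borel_measurable (F 0) \<and>
     (\<forall>i<len S. coef S i \<in> borel_measurable (filtration.pre_sigma (space M) F (time S i)))"

definition simple_value :: "'a simple_process \<Rightarrow> real \<Rightarrow> 'a \<Rightarrow> real" where
  "simple_value S t \<omega> = init S \<omega> * indicator {0} t +
     (\<Sum>i<len S. coef S i \<omega> * indicator {time S i \<omega><..time S (Suc i) \<omega>} t)"

text \<open>The elementary integral over \<open>(0,t]\<close>; the atom \<open>init S \<cdot> Y\<^sub>0\<close> at time 0 is left out.\<close>

definition simple_integral ::
    "'a simple_process \<Rightarrow> (real \<Rightarrow> 'a \<Rightarrow> real) \<Rightarrow> real \<Rightarrow> 'a \<Rightarrow> real" where
  "simple_integral S Y t \<omega> =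
     (\<Sum>i<len S. coef S i \<omega> *
        (Y (min t (time S (Suc i) \<omega>)) \<omega> - Y (min t (time S i \<omega>)) \<omega>))"

text \<open>
  A semimartingale is a good integrator: for every \<open>t\<close>, integration over \<open>[0,t]\<close> is continuous from
  the simple predictable processes with uniform convergence on \<open>[0,\<infinity>) \<times> \<Omega>\<close> to the random
  variables with convergence in probability.
\<close>

definition semimartingale ::
    "'a measure \<Rightarrow> (real \<Rightarrow> 'a measure) \<Rightarrow> (real \<Rightarrow> 'a \<Rightarrow> real) \<Rightarrow> bool" where
  "semimartingale M F Y \<longleftrightarrow>
     adapted F Y \<and> (AE \<omega> in M. cadlag (\<lambda>t. Y t \<omega>)) \<and>
     (\<forall>t\<ge>0. \<forall>S S'. (\<forall>k. simple_predictable M F (S k)) \<and> simple_predictable M F S' \<and>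
        uniform_limit ({0..} \<times> space M)
          (\<lambda>k (s, \<omega>). simple_value (S k) s \<omega>) (\<lambda>(s, \<omega>). simple_value S' s \<omega>) sequentially
        \<longrightarrow> tendsto_in_prob M
              (\<lambda>k \<omega>. init (S k) \<omega> * Y 0 \<omega> + simple_integral (S k) Y t \<omega>)
              (\<lambda>\<omega>. init S' \<omega> * Y 0 \<omega> + simple_integral S' Y t \<omega>) sequentially)"

text \<open>
  \<open>is_stochastic_integral M F H Y Z\<close> means that \<open>Z\<^sub>t\<close> is the integral of \<open>H\<close> with respect to \<open>Y\<close>
  over \<open>(0,t]\<close>, for \<open>H\<close> adapted with left-continuous paths having right limits. It is the
  continuous extension of the elementary integral for ucp convergence: \<open>H\<close> is a ucp limit of
  simple predictable processes, and along each such approximation the integrals tend to \<open>Z\<close>. For a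
  semimartingale \<open>Y\<close> such a \<open>Z\<close> exists and is unique up to indistinguishability.
\<close>

definition is_stochastic_integral ::
    "'a measure \<Rightarrow> (real \<Rightarrow> 'a measure) \<Rightarrow> (real \<Rightarrow> 'a \<Rightarrow> real) \<Rightarrow> (real \<Rightarrow> 'a \<Rightarrow> real)
      \<Rightarrow> (real \<Rightarrow> 'a \<Rightarrow> real) \<Rightarrow> bool" where
  "is_stochastic_integral M F H Y Z \<longleftrightarrow>
     semimartingale M F Y \<and>
     adapted F H \<and> (AE \<omega> in M. caglad (\<lambda>t. H t \<omega>)) \<and>
     adapted F Z \<and> (AE \<omega> in M. cadlag (\<lambda>t. Z t \<omega>)) \<and>
     (\<exists>S. (\<forall>k. simple_predictable M F (S k)) \<and> ucp_tendsto M (\<lambda>k. simple_value (S k)) H) \<and>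
     (\<forall>S. (\<forall>k. simple_predictable M F (S k)) \<and> ucp_tendsto M (\<lambda>k. simple_value (S k)) H
        \<longrightarrow> ucp_tendsto M (\<lambda>k. simple_integral (S k) Y) Z)"

definition sde_solution ::
    "'a measure \<Rightarrow> (real \<Rightarrow> 'a measure) \<Rightarrow> (real \<Rightarrow> real) \<Rightarrow> (real \<Rightarrow> 'a \<Rightarrow> real) \<Rightarrow> real
      \<Rightarrow> (real \<Rightarrow> 'a \<Rightarrow> real) \<Rightarrow> bool" where
  "sde_solution M F \<sigma> L x X \<longleftrightarrow>
     semimartingale M F X \<and>
     (\<exists>Z. is_stochastic_integral M F (\<lambda>t \<omega>. \<sigma> (left_limit X t \<omega>)) L Z \<and>
          (AE \<omega> in M. \<forall>t\<ge>0. X t \<omega> = x + Z t \<omega>))"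


section \<open>L\'evy processes\<close>

text \<open>
  As usual on a filtered space, the increments are independent of the past with respect to the
  given filtration; this is what makes a L\'evy process a semimartingale for that filtration.
\<close>

definition levy_process ::
    "'a measure \<Rightarrow> (real \<Rightarrow> 'a measure) \<Rightarrow> (real \<Rightarrow> 'a \<Rightarrow> real) \<Rightarrow> bool" where
  "levy_process M F L \<longleftrightarrow>
     adapted F L \<and>
     (AE \<omega> in M. L 0 \<omega> = 0) \<and>
     (\<forall>s\<ge>0. \<forall>t\<ge>s. prob_space.indep_set M (sets (F s))
        (sets (vimage_algebra (space M) (\<lambda>\<omega>. L t \<omega> - L s \<omega>) borel))) \<and>
     (\<forall>s\<ge>0. \<forall>t\<ge>s. distr M borel (\<lambda>\<omega>. L t \<omega> - L s \<omega>) = distr M borel (L (t - s))) \<and>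
     (AE \<omega> in M. cadlag (\<lambda>t. L t \<omega>))"

definition levy_measure :: "real measure \<Rightarrow> bool" where
  "levy_measure \<nu> \<longleftrightarrow> sets \<nu> = sets borel \<and> emeasure \<nu> {0} = 0 \<and>
     (\<integral>\<^sup>+ s. ennreal (min 1 (s\<^sup>2)) \<partial>\<nu>) < \<infinity>"

definition levy_exponent :: "real \<Rightarrow> real measure \<Rightarrow> real \<Rightarrow> real \<Rightarrow> complex" where
  "levy_exponent A \<nu> \<gamma> u =
     \<i> * complex_of_real (\<gamma> * u) - complex_of_real (A * u\<^sup>2 / 2) +
     (CLINT s|\<nu>. iexp (u * s) - 1 - \<i> * complex_of_real (u * s * indicator {-1..1} s))"

definition characteristic_triplet ::
    "'a measure \<Rightarrow> (real \<Rightarrow> 'a \<Rightarrow> real) \<Rightarrow> real \<Rightarrow> real measure \<Rightarrow> real \<Rightarrow> bool" where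
  "characteristic_triplet M L A \<nu> \<gamma> \<longleftrightarrow>
     A \<ge> 0 \<and> levy_measure \<nu> \<and>
     (\<forall>t\<ge>0. \<forall>u. char (distr M borel (L t)) u = exp (complex_of_real t * levy_exponent A \<nu> \<gamma> u))"

definition drift_exists :: "real measure \<Rightarrow> bool" where
  "drift_exists \<nu> \<longleftrightarrow> (\<integral>\<^sup>+ s\<in>{-1..1}. ennreal \<bar>s\<bar> \<partial>\<nu>) < \<infinity>"

definition drift :: "real measure \<Rightarrow> real \<Rightarrow> real" where
  "drift \<nu> \<gamma> = \<gamma> - (LINT s:{-1..1}|\<nu>. s)"


section \<open>Conditions on functions\<close>

definition regularly_varying_at_zero :: "real \<Rightarrow> (real \<Rightarrow> real) \<Rightarrow> bool" where
  "regularly_varying_at_zero a f \<longleftrightarrow>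
     (\<forall>c>0. ((\<lambda>t. f (c * t) / f t) \<longlongrightarrow> c powr a) (at_right 0))"

definition twice_continuously_differentiable :: "(real \<Rightarrow> real) \<Rightarrow> bool" where
  "twice_continuously_differentiable g \<longleftrightarrow>
     (\<exists>g' g''. (\<forall>y. (g has_real_derivative g' y) (at y)) \<and>
               (\<forall>y. (g' has_real_derivative g'' y) (at y)) \<and> continuous_on UNIV g'')"

definition at_most_linear_growth :: "(real \<Rightarrow> real) \<Rightarrow> bool" where
  "at_most_linear_growth g \<longleftrightarrow> (\<exists>C. \<forall>y. \<bar>g y\<bar> \<le> C * (1 + \<bar>y\<bar>))"

end

theory Submission
  imports Defs
begin

text \<open>
  The remainder \<open>X t - x - \<sigma> x * L t\<close> is the integral of \<open>\<sigma> (X\<^sub>-) - \<sigma> x\<close> against \<open>L\<close>. It is of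
  order \<open>t\<close> in probability, and \<open>t / f t\<close> tends to 0 because \<open>a < 1\<close>. The order is found without the
  Levy-Ito decomposition. Up to an event of probability \<open>O(t)\<close> the integral is close to a
  Riemann sum over a grid of mesh \<open>h\<close>. Increments of \<open>L\<close> larger than 1 occur on the grid with
  probability at most \<open>K * t\<close>. For the remaining increments the characteristic exponent bounds mean and
  second moment by \<open>K * h\<close>, so that a sum of adapted coefficients \<open>D\<^sub>j\<close> times truncated increments
  has second moment \<open>O(t)\<close> times the largest second moment of the \<open>D\<^sub>j\<close>. Before \<open>X\<close> leaves \<open>[x - 1, x + 1]\<close>,
  this gives first \<open>E (X s - x)\<^sup>2 = O(s)\<close>, with coefficients \<open>\<sigma> (X s)\<close>, and then the bound \<open>O(t\<^sup>2)\<close>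
  for the second moment of the remainder, with coefficients \<open>\<sigma> (X s) - \<sigma> x\<close>.
\<close>

section \<open>Regular variation\<close>

text \<open>The obstacle is the form of the integral: it is given by ucp limits of elementary
  integrals with random times, which carry no moment estimates by themselves. Step processes on a
  deterministic grid cannot be fed into this definition, since they do not follow the jumps of
  \<open>X\<close> uniformly; yet deterministic times are what lets independence act cell by cell.
  The two are joined by Riemann sums of the approximating simple processes. All estimates depend on
  the grid only through \<open>h * n = t\<close>, so the mesh is chosen last and no rate of
  convergence enters. \<open>L\<close> may lack moments, hence the truncation; truncated increments
  are not centred, but a mean of order \<open>h\<close> costs only a bounded growth factor. An
  exceptional event of probability O(t) is harmless twice: in the conclusion because it vanishes
  with \<open>t\<close>, and in the estimate of \<open>(X s - x)^2\<close> because this square is at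
  most 1 before escape. Since \<open>\<sigma>\<close> is controlled near \<open>x\<close>, the
  coefficients are switched off after escape, whose probability only has to tend to 0.\<close>

lemma regularly_varying_at_zero_dominates_identity:
  fixes f :: "real \<Rightarrow> real"
  assumes mono: "mono_on {0..} f" and nonneg: "\<forall>t\<ge>0. f t \<ge> 0"
    and rv: "regularly_varying_at_zero a f" and "a < 1"
  shows "eventually (\<lambda>t. 0 < f t) (at_right 0)"
    and "((\<lambda>t. t / f t) \<longlongrightarrow> 0) (at_right 0)"
proof -
  \<comment> \<open>Only the ratio at scale 1/2 is used. As \<open>a < 1\<close>, a number
    \<open>b\<close> fits strictly between 1/2 and the limit \<open>(1/2) powr a\<close>, so each
    halving of \<open>t\<close> multiplies \<open>t / f t\<close> by at most
    \<open>r = 1 / (2 * b) < 1\<close>. This is geometric decay along dyadic times; monotonicity of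
    \<open>f\<close> bridges the gaps.\<close>
  define b where "b = (1 / 2 + (1 / 2) powr a) / 2"
  have "(1 / 2 :: real) powr 1 < (1 / 2) powr a"
    using \<open>a < 1\<close> by (intro powr_less_mono') auto
  then have b: "1 / 2 < b" "b < (1 / 2) powr a" by (auto simp: b_def)
  have "((\<lambda>t. f (1 / 2 * t) / f t) \<longlongrightarrow> (1 / 2) powr a) (at_right 0)"
    using rv unfolding regularly_varying_at_zero_def by (metis half_gt_zero zero_less_one)
  then have "eventually (\<lambda>t. b < f (1 / 2 * t) / f t) (at_right 0)"
    using b by (auto simp: order_tendsto_iff)
  then obtain t0 where t0: "t0 > 0" "\<And>t. 0 < t \<Longrightarrow> t < t0 \<Longrightarrow> b < f (1 / 2 * t) / f t"
    unfolding eventually_at_right_field by auto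
  have pos: "0 < f t" if "0 < t" "t < t0" for t
  proof -
    \<comment> \<open>A quotient by 0 is 0 in HOL, hence not above \<open>b\<close>.\<close>
    have "f t \<noteq> 0" using t0(2)[OF that] b by auto
    then show ?thesis using nonneg that by (simp add: order_less_le)
  qed
  show "eventually (\<lambda>t. 0 < f t) (at_right 0)"
    unfolding eventually_at_right_field using t0(1) pos by blast
  have half: "b * f t \<le> f (t / 2)" if "0 < t" "t < t0" for t
    using t0(2)[OF that] pos[OF that] by (simp add: field_simps)
  define q where "q t = t / f t" for t
  define r where "r = 1 / (2 * b)"
  have r: "0 < r" "r < 1" using b by (auto simp: r_def field_simps)
  define t1 where "t1 = t0 / 2"
  have t1: "0 < t1" "t1 < t0" using t0(1) by (auto simp: t1_def)
  have t1n: "0 < t1 / 2 ^ n" "t1 / 2 ^ n < t0" for n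
  proof -
    have "t1 / 2 ^ n \<le> t1 / 1" using t1 by (intro divide_left_mono) auto
    then show "t1 / 2 ^ n < t0" using t1 by simp
  qed (use t1 in simp)
  have q_half: "q (t / 2) \<le> r * q t" if "0 < t" "t < t0" for t
  proof -
    have "q (t / 2) \<le> (t / 2) / (b * f t)"
      unfolding q_def using half[OF that] pos[OF that] pos[of "t/2"] that b
      by (intro divide_left_mono) auto
    then show ?thesis by (simp add: q_def r_def)
  qed
  have q_n: "q (t1 / 2 ^ n) \<le> r ^ n * q t1" for n
  proof (induction n)
    case (Suc n)
    have "q (t1 / 2 ^ Suc n) \<le> r * q (t1 / 2 ^ n)"
      using q_half[OF t1n] by (simp add: field_simps)
    also have "\<dots> \<le> r * (r ^ n * q t1)" using Suc r by (intro mult_left_mono) auto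
    finally show ?case by simp
  qed simp
  have "((\<lambda>n. 2 * (r ^ n * q t1)) \<longlonglongrightarrow> 2 * (0 * q t1))"
    using r by (intro tendsto_intros LIMSEQ_power_zero) auto
  then have lim: "((\<lambda>n. 2 * (r ^ n * q t1)) \<longlonglongrightarrow> 0)" by simp
  have "eventually (\<lambda>t. \<bar>q t\<bar> < e) (at_right 0)" if "e > 0" for e
  proof -
    obtain N where N: "\<And>n. n \<ge> N \<Longrightarrow> 2 * (r ^ n * q t1) < e"
      using order_tendstoD(2)[OF lim \<open>e > 0\<close>] by (auto simp: eventually_sequentially)
    have "\<bar>q t\<bar> < e" if t: "0 < t" "t < t1 / 2 ^ N" for t
    proof -
      have tt: "t < t0" using t t1n[of N] by linarith
      obtain m where "t1 / 2 ^ m < t"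
      proof -
        obtain m where "(1 / 2 :: real) ^ m < t / t1"
          using real_arch_pow_inv[of "t / t1" "1/2"] t t1 by auto
        then show ?thesis using that t1 by (simp add: field_simps power_one_over)
      qed
      moreover have "\<not> t1 / 2 ^ 0 < t"
      proof -
        have "t1 / 2 ^ N \<le> t1 / 1" using t1 by (intro divide_left_mono) auto
        then show ?thesis using t by simp
      qed
      ultimately obtain n where n: "t1 / 2 ^ Suc n < t" "\<not> t1 / 2 ^ n < t"
        using ex_least_nat_less[of "\<lambda>m. t1 / 2 ^ m < t" m] by auto
      have "N \<le> Suc n"
      proof (rule ccontr)
        assume "\<not> N \<le> Suc n"
        then have "t1 / 2 ^ N \<le> t1 / 2 ^ Suc n"
          using t1 by (intro divide_left_mono power_increasing) auto
        then show False using n t by linarith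
      qed
      \<comment> \<open>\<open>t\<close> lies in the dyadic cell from \<open>t1 / 2^(n+1)\<close> to
        \<open>t1 / 2^n\<close>. The numerator is taken at the right end, the denominator by
        monotonicity at the left end; the quotient of the ends is the factor 2 built into the choice
        of \<open>N\<close>.\<close>
      have "q t \<le> (t1 / 2 ^ n) / f (t1 / 2 ^ Suc n)"
        unfolding q_def
      proof (intro frac_le)
        show "f (t1 / 2 ^ Suc n) \<le> f t"
          using n t1n[of "Suc n"] t by (intro mono_onD[OF mono]) auto
      qed (use n t pos t1n[of "Suc n"] t1n[of n] in \<open>auto simp: not_less\<close>)
      also have "\<dots> = 2 * q (t1 / 2 ^ Suc n)" by (simp add: q_def)
      also have "\<dots> \<le> 2 * (r ^ Suc n * q t1)" using q_n[of "Suc n"] by simp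
      also have "\<dots> < e" by (rule N) fact
      finally show ?thesis using t pos[OF t(1) tt] by (simp add: q_def)
    qed
    then show ?thesis unfolding eventually_at_right_field using t1n(1)[of N] by blast
  qed
  then show "((\<lambda>t. t / f t) \<longlongrightarrow> 0) (at_right 0)"
    unfolding tendsto_iff dist_real_def q_def by simp
qed

section \<open>Small-time moment bounds from the characteristic exponent\<close>

text \<open>The derivative of \<open>exp\<close> has modulus at most 1 on the left half-plane, which
  is convex, so the mean value inequality applies. This turns a bound on a characteristic exponent
  into a bound, linear in time, on the distance of the characteristic function from 1.\<close>

lemma norm_exp_minus_one_le:
  fixes z :: complex
  assumes "Re z \<le> 0"
  shows "norm (exp z - 1) \<le> norm z"
proof -
  have "norm (exp z - exp 0) \<le> 1 * norm (z - 0)"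
  proof (rule field_differentiable_bound[where f' = exp])
    show "convex {w::complex. Re w \<le> 0}" by (rule convex_halfspace_Re_le)
    show "(exp has_field_derivative exp w) (at w within {w. Re w \<le> 0})" for w :: complex
      by (rule DERIV_subset[OF DERIV_exp]) auto
  qed (use assms in auto)
  then show ?thesis by simp
qed

text \<open>
  Averaging over a Gaussian frequency turns the bound on \<open>1 - Re (char M u)\<close>, known for each
  single \<open>u\<close>, into one on a function of \<open>y\<close> that is comparable to \<open>min 1 (y\<^sup>2)\<close>.
\<close>

lemma (in real_distribution) integral_gaussian_eq_char:
  "(LINT u|std_normal_distribution. 1 - Re (char M u)) = (LINT y|M. 1 - exp (- (y\<^sup>2) / 2))"
proof -
  interpret N: real_distribution std_normal_distribution by (rule real_dist_normal_dist)
  interpret P: pair_sigma_finite std_normal_distribution M ..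
  interpret P': pair_prob_space std_normal_distribution M ..
  have int: "integrable (std_normal_distribution \<Otimes>\<^sub>M M) (\<lambda>(u, y). iexp (u * y))"
    by (rule P'.P.integrable_const_bound[where B = 1]) auto
  have intN: "integrable std_normal_distribution (char M)"
    by (rule N.integrable_const_bound[where B = 1]) (auto simp: cmod_char_le_1)
  have intM: "integrable M (\<lambda>y. exp (- (y\<^sup>2) / 2))"
    by (rule integrable_const_bound[where B = 1]) auto
  have "(CLINT u|std_normal_distribution. char M u) = (CLINT y|M. (CLINT u|std_normal_distribution. iexp (u * y)))"
    unfolding char_def by (rule P.Fubini_integral[OF int, symmetric])
  also have "\<dots> = (CLINT y|M. char std_normal_distribution y)"
    unfolding char_def by (simp add: mult.commute)
  also have "\<dots> = complex_of_real (LINT y|M. exp (- (y\<^sup>2) / 2))"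
    unfolding char_std_normal_distribution by (rule integral_complex_of_real)
  finally have "Re (CLINT u|std_normal_distribution. char M u) = (LINT y|M. exp (- (y\<^sup>2) / 2))"
    by simp
  then have "(LINT u|std_normal_distribution. Re (char M u)) = (LINT y|M. exp (- (y\<^sup>2) / 2))"
    using intN by simp
  then show ?thesis
    using intN intM N.prob_space prob_space by simp
qed

text \<open>By \<open>exp (- z) \<le> 1 / (1 + z)\<close> at \<open>z = y^2 / 2\<close> the claim
  reduces to \<open>min 1 (2 * z) \<le> 3 * z / (1 + z)\<close>; equality at
  \<open>2 * z = 1\<close> is the origin of the 3.\<close>

lemma min_one_square_le_gaussian:
  fixes y :: real
  shows "min 1 (y\<^sup>2) \<le> 3 * (1 - exp (- (y\<^sup>2) / 2))"
proof -
  define z where "z = y\<^sup>2 / 2"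
  have z: "0 \<le> z" "y\<^sup>2 = 2 * z" by (auto simp: z_def)
  have "exp (- z) \<le> 1 / (1 + z)"
    using exp_ge_add_one_self[of z] z by (simp add: exp_minus field_simps)
  moreover have "min 1 (2 * z) \<le> 3 * (1 - 1 / (1 + z))"
  proof (cases "2 * z \<le> 1")
    case True
    then have "2 * z * (1 + z) \<le> 3 * z" using z mult_left_mono[of "2 * z" 1 z] by (simp add: algebra_simps)
    then show ?thesis using True z by (simp add: field_simps)
  qed (use z in \<open>auto simp: field_simps\<close>)
  ultimately show ?thesis by (simp add: z(2))
qed

text \<open>A cut-off by 0 rather than a clamp: it is the identity on increments of size at most 1,
  so truncated and full Riemann sums agree exactly unless a larger increment occurs.\<close>

definition small_part :: "real \<Rightarrow> real" where
  "small_part y = (if \<bar>y\<bar> \<le> 1 then y else 0)"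

lemma small_part_measurable [measurable]: "small_part \<in> borel_measurable borel"
  unfolding small_part_def by measurable

lemma abs_small_part_le: "\<bar>small_part y\<bar> \<le> 1"
  by (simp add: small_part_def)

lemma small_part_square_le: "(small_part y)\<^sup>2 \<le> min 1 (y\<^sup>2)"
  by (auto simp: small_part_def abs_square_le_1)

text \<open>\<open>sin\<close> is a substitute for the truncation whose mean can be read off a
  characteristic function; the error is of second order, so the second-moment estimate controls
  it.\<close>

lemma small_part_minus_sin_le: "\<bar>small_part y - sin y\<bar> \<le> min 1 (y\<^sup>2)"
proof (cases "\<bar>y\<bar> \<le> 1")
  case True
  have "\<bar>sin y - y\<bar> \<le> y\<^sup>2"
  proof -
    have "norm (iexp y - (\<Sum>k\<le>1. (\<i> * y) ^ k / fact k)) \<le> \<bar>y\<bar> ^ 2 / 2"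
      using iexp_approx1[of y 1] by (simp add: numeral_2_eq_2)
    moreover have "Im (iexp y - (\<Sum>k\<le>1. (\<i> * y) ^ k / fact k)) = sin y - y"
      by (simp add: Im_exp)
    ultimately have "\<bar>sin y - y\<bar> \<le> \<bar>y\<bar> ^ 2 / 2"
      using abs_Im_le_cmod[of "iexp y - (\<Sum>k\<le>1. (\<i> * y) ^ k / fact k)"] by simp
    also have "\<dots> \<le> y\<^sup>2" by simp
    finally show ?thesis .
  qed
  then show ?thesis using True abs_square_le_1[of y]
    by (simp add: small_part_def abs_minus_commute min_def)
next
  case False
  then have "1 \<le> y\<^sup>2" by (metis abs_square_le_1 less_eq_real_def not_le)
  then show ?thesis using False by (simp add: small_part_def)
qed

text \<open>Tail and square are both dominated by \<open>min 1 (y^2)\<close>. The 6 is the 3 of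
  \<open>min_one_square_le_gaussian\<close> times the mean 2 of \<open>1 + u^2\<close> under the
  Gaussian frequency. For the first moment, the mean of \<open>sin\<close> is the imaginary part of
  the characteristic function at frequency 1 and costs another \<open>2 * C * h\<close>, whence
  8.\<close>

lemma (in real_distribution) moment_bounds_of_char_exponent:
  fixes \<psi> :: "real \<Rightarrow> complex"
  assumes char: "\<And>u. char M u = exp (complex_of_real h * \<psi> u)" and "0 \<le> h"
    and bound: "\<And>u. norm (\<psi> u) \<le> C * (1 + u\<^sup>2)"
  shows "measure M {y. 1 < \<bar>y\<bar>} \<le> 6 * C * h"
    and "(LINT y|M. (small_part y)\<^sup>2) \<le> 6 * C * h"
    and "\<bar>LINT y|M. small_part y\<bar> \<le> 8 * C * h"
proof -
  interpret N: real_distribution std_normal_distribution by (rule real_dist_normal_dist)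
  have le: "norm (char M u - 1) \<le> h * (C * (1 + u\<^sup>2))" for u
  proof -
    \<comment> \<open>That the exponent has nonpositive real part is read off from the modulus of
      the characteristic function being at most 1.\<close>
    have "exp (Re (complex_of_real h * \<psi> u)) \<le> 1"
      using cmod_char_le_1[of u] by (simp add: char)
    then have "norm (exp (complex_of_real h * \<psi> u) - 1) \<le> norm (complex_of_real h * \<psi> u)"
      by (intro norm_exp_minus_one_le) auto
    also have "\<dots> \<le> h * (C * (1 + u\<^sup>2))"
      using \<open>0 \<le> h\<close> bound[of u] by (simp add: norm_mult mult_left_mono)
    finally show ?thesis by (simp add: char)
  qed
  have intN: "integrable std_normal_distribution (\<lambda>u. 1 + u\<^sup>2)"
    using integrable_std_normal_distribution_moment[of 2] by simp
  have mom: "(LINT u|std_normal_distribution. 1 + u\<^sup>2) = 2"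
    using integrable_std_normal_distribution_moment[of 2] std_normal_distribution_even_moments(1)[of 1]
      N.prob_space by (simp add: fact_numeral)
  have "(LINT u|std_normal_distribution. 1 - Re (char M u)) \<le> (LINT u|std_normal_distribution. h * C * (1 + u\<^sup>2))"
  proof (intro integral_mono)
    show "integrable std_normal_distribution (\<lambda>u. 1 - Re (char M u))"
    proof (rule N.integrable_const_bound[where B = 2])
      show "AE u in std_normal_distribution. norm (1 - Re (char M u)) \<le> 2"
      proof (rule AE_I2)
        fix u
        have "\<bar>Re (char M u)\<bar> \<le> 1" by (rule order_trans[OF abs_Re_le_cmod cmod_char_le_1])
        then show "norm (1 - Re (char M u)) \<le> 2" unfolding real_norm_def by linarith
      qed
    qed auto
    show "1 - Re (char M u) \<le> h * C * (1 + u\<^sup>2)" for u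
      using le[of u] abs_Re_le_cmod[of "char M u - 1"] by (simp add: mult.assoc)
  qed (use intN in auto)
  also have "\<dots> = h * C * 2" using mom by (simp del: integral_add)
  finally have g: "(LINT y|M. 1 - exp (- (y\<^sup>2) / 2)) \<le> 2 * C * h"
    unfolding integral_gaussian_eq_char by (simp add: algebra_simps)
  have int_min: "integrable M (\<lambda>y. min 1 (y\<^sup>2))"
    by (rule integrable_const_bound[where B = 1]) auto
  have "(LINT y|M. min 1 (y\<^sup>2)) \<le> (LINT y|M. 3 * (1 - exp (- (y\<^sup>2) / 2)))"
  proof (intro integral_mono int_min)
    show "integrable M (\<lambda>y. 3 * (1 - exp (- (y\<^sup>2) / 2)))"
      by (rule integrable_const_bound[where B = 3]) auto
  qed (rule min_one_square_le_gaussian)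
  also have "\<dots> = 3 * (LINT y|M. 1 - exp (- (y\<^sup>2) / 2))" by (rule integral_mult_right_zero)
  finally have 1: "(LINT y|M. min 1 (y\<^sup>2)) \<le> 6 * C * h" using g by simp
  have "measure M {y. 1 < \<bar>y\<bar>} = (LINT y|M. indicator {y. 1 < \<bar>y\<bar>} y)" by simp
  also have "\<dots> \<le> (LINT y|M. min 1 (y\<^sup>2))"
  proof (intro integral_mono int_min)
    show "indicator {y. 1 < \<bar>y\<bar>} y \<le> min 1 (y\<^sup>2)" for y :: real
      using abs_square_le_1[of y] by (auto simp: indicator_def)
  qed (auto simp: less_top[symmetric])
  finally show "measure M {y. 1 < \<bar>y\<bar>} \<le> 6 * C * h" using 1 by simp
  have int_sq: "integrable M (\<lambda>y. (small_part y)\<^sup>2)"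
    by (rule integrable_const_bound[where B = 1]) (auto simp: abs_small_part_le abs_square_le_1)
  have "(LINT y|M. (small_part y)\<^sup>2) \<le> (LINT y|M. min 1 (y\<^sup>2))"
    by (intro integral_mono int_min int_sq small_part_square_le)
  then show "(LINT y|M. (small_part y)\<^sup>2) \<le> 6 * C * h" using 1 by simp
  have int_iexp: "integrable M (\<lambda>y. iexp (1 * y))"
    by (rule integrable_const_bound[where B = 1]) auto
  have int_sin: "integrable M sin"
    by (rule integrable_const_bound[where B = 1]) auto
  have int_small: "integrable M small_part"
    by (rule integrable_const_bound[where B = 1]) (auto simp: abs_small_part_le)
  have "Im (char M 1) = (LINT y|M. Im (iexp (1 * y)))"
    unfolding char_def using int_iexp by (simp del: mult_1)
  then have "Im (char M 1 - 1) = (LINT y|M. sin y)" by (simp add: Im_exp)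
  then have s: "\<bar>LINT y|M. sin y\<bar> \<le> 2 * C * h"
    using le[of 1] abs_Im_le_cmod[of "char M 1 - 1"] by (simp add: mult.commute)
  have "\<bar>LINT y|M. small_part y - sin y\<bar> \<le> (LINT y|M. \<bar>small_part y - sin y\<bar>)"
    by (rule integral_abs_bound)
  also have "\<dots> \<le> (LINT y|M. min 1 (y\<^sup>2))"
    using int_small int_sin by (intro integral_mono int_min small_part_minus_sin_le) auto
  finally have "\<bar>(LINT y|M. small_part y) - (LINT y|M. sin y)\<bar> \<le> 6 * C * h"
    using 1 int_small int_sin by simp
  then show "\<bar>LINT y|M. small_part y\<bar> \<le> 8 * C * h" using s by linarith
qed

text \<open>Second-order Taylor remainder on \<open>[-1, 1]\<close>; outside, the compensator
  vanishes and the trivial bound 2 remains. The factor \<open>2 + u^2\<close> covers both cases and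
  leaves the function of \<open>s\<close> that a Levy measure integrates.\<close>

lemma levy_integrand_le:
  fixes u s :: real
  shows "norm (iexp (u * s) - 1 - \<i> * complex_of_real (u * s * indicator {-1..1} s))
    \<le> (2 + u\<^sup>2) * min 1 (s\<^sup>2)"
proof (cases "\<bar>s\<bar> \<le> 1")
  case True
  then have ind: "indicator {-1..1} s = (1::real)" by (auto simp: indicator_def)
  have "norm (iexp (u * s) - (\<Sum>k\<le>1. (\<i> * (u * s)) ^ k / fact k)) \<le> \<bar>u * s\<bar> ^ 2 / 2"
    using iexp_approx1[of "u * s" 1] by (simp add: numeral_2_eq_2)
  moreover have "(\<Sum>k\<le>1. (\<i> * complex_of_real (u * s)) ^ k / fact k) = 1 + \<i> * complex_of_real (u * s)"
    by simp
  ultimately have "norm (iexp (u * s) - 1 - \<i> * complex_of_real (u * s)) \<le> (u * s)\<^sup>2 / 2"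
    by (simp add: algebra_simps)
  also have "\<dots> \<le> (2 + u\<^sup>2) * s\<^sup>2" by (simp add: power_mult_distrib field_simps)
  also have "s\<^sup>2 = min 1 (s\<^sup>2)" using True abs_square_le_1[of s] by (simp add: min_def)
  finally show ?thesis by (simp add: ind)
next
  case False
  then have ind: "indicator {-1..1} s = (0::real)" by (auto simp: indicator_def)
  have "norm (iexp (u * s) - 1) \<le> 1 + 1"
    using norm_triangle_ineq4[of "iexp (u * s)" 1] by simp
  moreover have "1 \<le> s\<^sup>2" using False by (metis abs_square_le_1 less_eq_real_def not_le)
  ultimately have "norm (iexp (u * s) - 1) \<le> (2 + u\<^sup>2) * min 1 (s\<^sup>2)"
    using zero_le_power2[of u] by (simp only: min_absorb1 mult_1_right)
  then show ?thesis by (simp add: ind)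
qed

lemma levy_exponent_quadratic_bound:
  assumes "levy_measure \<nu>"
  obtains C where "0 \<le> C" "\<And>u. norm (levy_exponent A \<nu> \<gamma> u) \<le> C * (1 + u\<^sup>2)"
proof -
  define I where "I = (LINT s|\<nu>. min 1 (s\<^sup>2))"
  have [measurable_cong]: "sets \<nu> = sets borel"
    and fin: "(\<integral>\<^sup>+ s. ennreal (min 1 (s\<^sup>2)) \<partial>\<nu>) < \<infinity>"
    using assms by (auto simp: levy_measure_def)
  have int: "integrable \<nu> (\<lambda>s. min 1 (s\<^sup>2))"
    using fin by (intro integrableI_nonneg) auto
  have I: "0 \<le> I" by (auto simp: I_def)
  have "norm (levy_exponent A \<nu> \<gamma> u) \<le> (\<bar>\<gamma>\<bar> + \<bar>A\<bar> + 2 * I) * (1 + u\<^sup>2)" for u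
  proof -
    let ?J = "CLINT s|\<nu>. iexp (u * s) - 1 - \<i> * complex_of_real (u * s * indicator {-1..1} s)"
    have "norm ?J \<le> (LINT s|\<nu>. (2 + u\<^sup>2) * min 1 (s\<^sup>2))"
    proof (rule Bochner_Integration.integral_norm_bound_integral)
      show "integrable \<nu> (\<lambda>s. iexp (u * s) - 1 - \<i> * complex_of_real (u * s * indicator {-1..1} s))"
      proof (rule Bochner_Integration.integrable_bound)
        show "integrable \<nu> (\<lambda>s. (2 + u\<^sup>2) * min 1 (s\<^sup>2))" using int by simp
        show "AE s in \<nu>. norm (iexp (u * s) - 1 - \<i> * complex_of_real (u * s * indicator {-1..1} s))
            \<le> norm ((2 + u\<^sup>2) * min 1 (s\<^sup>2))"
          by (intro AE_I2 order_trans[OF levy_integrand_le]) simp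
      qed measurable
      show "integrable \<nu> (\<lambda>s. (2 + u\<^sup>2) * min 1 (s\<^sup>2))" using int by simp
    qed (rule levy_integrand_le)
    also have "\<dots> = (2 + u\<^sup>2) * I" by (simp add: I_def)
    also have "\<dots> \<le> 2 * I * (1 + u\<^sup>2)" using I by (simp add: algebra_simps)
    finally have J: "norm ?J \<le> 2 * I * (1 + u\<^sup>2)" .
    have g: "norm (\<i> * complex_of_real (\<gamma> * u)) \<le> \<bar>\<gamma>\<bar> * (1 + u\<^sup>2)"
    proof -
      have "\<bar>u\<bar> \<le> 1 + u\<^sup>2"
        using zero_le_power2[of "\<bar>u\<bar> - 1/2"] by (simp add: power2_diff power_divide)
      then have "\<bar>\<gamma>\<bar> * \<bar>u\<bar> \<le> \<bar>\<gamma>\<bar> * (1 + u\<^sup>2)" by (intro mult_left_mono) auto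
      then show ?thesis by (simp add: norm_mult abs_mult)
    qed
    have a: "norm (complex_of_real (A * u\<^sup>2 / 2)) \<le> \<bar>A\<bar> * (1 + u\<^sup>2)"
      unfolding norm_of_real by (simp add: abs_mult algebra_simps)
    have "norm (levy_exponent A \<nu> \<gamma> u)
      \<le> norm (\<i> * complex_of_real (\<gamma> * u)) + norm (complex_of_real (A * u\<^sup>2 / 2)) + norm ?J"
      unfolding levy_exponent_def
      by (intro order_trans[OF norm_triangle_ineq] add_mono norm_triangle_ineq4 order_refl)
    then show ?thesis using J g a by (simp add: algebra_simps)
  qed
  then show thesis using I by (intro that[of "\<bar>\<gamma>\<bar> + \<bar>A\<bar> + 2 * I"]) auto
qed

section \<open>Riemann sums against a Levy process\<close>

context filtered_prob_space
begin

lemma sets_F_le: "0 \<le> t \<Longrightarrow> sets (F t) \<subseteq> sets M"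
  using subalgebra_F by (simp add: subalgebra_def)

lemma borel_measurable_F_imp_M: "X \<in> borel_measurable (F t) \<Longrightarrow> 0 \<le> t \<Longrightarrow> X \<in> borel_measurable M"
  by (rule measurable_from_subalg[OF subalgebra_F])

lemma borel_measurable_F_mono:
  assumes "X \<in> borel_measurable (F s)" and "s \<le> t"
  shows "X \<in> borel_measurable (F t)"
  using assms sets_F_mono[of s t] by (auto simp: measurable_def space_F)

lemma adapted_imp_measurable: "adapted F X \<Longrightarrow> 0 \<le> t \<Longrightarrow> X t \<in> borel_measurable M"
  using borel_measurable_F_imp_M by (auto simp: adapted_def)

lemma integrable_bounded:
  fixes f :: "'a \<Rightarrow> real"
  assumes "f \<in> borel_measurable M" and "\<And>\<omega>. \<omega> \<in> space M \<Longrightarrow> \<bar>f \<omega>\<bar> \<le> B"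
  shows "integrable M f"
  using assms by (intro integrable_const_bound[where B = B] AE_I2) auto

end

text \<open>Coefficients sit at the left end of each cell: for adapted \<open>D\<close> they are
  known before the increment that they multiply.\<close>

definition riemann_sum ::
    "(real \<Rightarrow> 'a \<Rightarrow> real) \<Rightarrow> (real \<Rightarrow> 'a \<Rightarrow> real) \<Rightarrow> real \<Rightarrow> nat \<Rightarrow> 'a \<Rightarrow> real" where
  "riemann_sum D L h n \<omega> =
     (\<Sum>j<n. D (h * real j) \<omega> * (L (h * real (Suc j)) \<omega> - L (h * real j) \<omega>))"

definition truncated_riemann_sum ::
    "(real \<Rightarrow> 'a \<Rightarrow> real) \<Rightarrow> (real \<Rightarrow> 'a \<Rightarrow> real) \<Rightarrow> real \<Rightarrow> nat \<Rightarrow> 'a \<Rightarrow> real" where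
  "truncated_riemann_sum D L h n \<omega> =
     (\<Sum>j<n. D (h * real j) \<omega> * small_part (L (h * real (Suc j)) \<omega> - L (h * real j) \<omega>))"

text \<open>Besides independence and stationarity of increments, all that later estimates use about
  the law of \<open>L\<close> is in these three bounds, linear in elapsed time with a common
  constant. The triplet enters only when the locale is established.\<close>

locale levy_with_moment_rate = filtered_prob_space M F
  for M :: "'a measure" and F :: "real \<Rightarrow> 'a measure" +
  fixes L :: "real \<Rightarrow> 'a \<Rightarrow> real" and K :: real
  assumes levy: "levy_process M F L" and K_nonneg: "0 \<le> K"
    and tail_rate: "\<And>h. 0 \<le> h \<Longrightarrow> prob {\<omega> \<in> space M. 1 < \<bar>L h \<omega>\<bar>} \<le> K * h"
    and square_rate: "\<And>h. 0 \<le> h \<Longrightarrow> expectation (\<lambda>\<omega>. (small_part (L h \<omega>))\<^sup>2) \<le> K * h"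
    and mean_rate: "\<And>h. 0 \<le> h \<Longrightarrow> \<bar>expectation (\<lambda>\<omega>. small_part (L h \<omega>))\<bar> \<le> K * h"

lemma (in filtered_prob_space) levy_with_moment_rateI:
  assumes levy: "levy_process M F L" and triplet: "characteristic_triplet M L A \<nu> \<gamma>"
  obtains K where "levy_with_moment_rate M F L K"
proof -
  from triplet have "levy_measure \<nu>" and char: "\<And>t u. 0 \<le> t \<Longrightarrow>
      char (distr M borel (L t)) u = exp (complex_of_real t * levy_exponent A \<nu> \<gamma> u)"
    by (auto simp: characteristic_triplet_def)
  then obtain C where C: "0 \<le> C" "\<And>u. norm (levy_exponent A \<nu> \<gamma> u) \<le> C * (1 + u\<^sup>2)"
    using levy_exponent_quadratic_bound by blast
  have "levy_with_moment_rate M F L (8 * C)"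
  proof unfold_locales
    fix h :: real assume h: "0 \<le> h"
    have [measurable]: "L h \<in> borel_measurable M"
      using levy h by (auto simp: levy_process_def intro: adapted_imp_measurable)
    interpret D: real_distribution "distr M borel (L h)" by (rule real_distribution_distr) simp
    have le: "6 * C * h \<le> 8 * C * h" using C h by (intro mult_right_mono) auto
    note b = D.moment_bounds_of_char_exponent[OF char[OF h] h C(2)]
    have "prob {\<omega> \<in> space M. 1 < \<bar>L h \<omega>\<bar>} = measure (distr M borel (L h)) {y. 1 < \<bar>y\<bar>}"
      by (subst measure_distr) (auto intro!: arg_cong[where f = prob])
    then show "prob {\<omega> \<in> space M. 1 < \<bar>L h \<omega>\<bar>} \<le> 8 * C * h"
      using b(1) le by simp
    show "expectation (\<lambda>\<omega>. (small_part (L h \<omega>))\<^sup>2) \<le> 8 * C * h"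
      using b(2) le by (simp add: integral_distr)
    show "\<bar>expectation (\<lambda>\<omega>. small_part (L h \<omega>))\<bar> \<le> 8 * C * h"
      using b(3) by (simp add: integral_distr)
  qed (use levy C in auto)
  then show thesis by (rule that)
qed

section \<open>Second moments of sums with adapted coefficients\<close>

context levy_with_moment_rate
begin

lemma L_adapted: "adapted F L" using levy by (simp add: levy_process_def)

lemma L_measurable [measurable]: "0 \<le> t \<Longrightarrow> L t \<in> borel_measurable M"
  by (rule adapted_imp_measurable[OF L_adapted])

lemma distr_increment:
  "0 \<le> s \<Longrightarrow> s \<le> t \<Longrightarrow> distr M borel (\<lambda>\<omega>. L t \<omega> - L s \<omega>) = distr M borel (L (t - s))"
  using levy by (auto simp: levy_process_def)

lemma expectation_increment:
  fixes g :: "real \<Rightarrow> real"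
  assumes [measurable]: "g \<in> borel_measurable borel" and st: "0 \<le> s" "s \<le> t"
  shows "expectation (\<lambda>\<omega>. g (L t \<omega> - L s \<omega>)) = expectation (\<lambda>\<omega>. g (L (t - s) \<omega>))"
proof -
  have [measurable]: "L t \<in> borel_measurable M" "L s \<in> borel_measurable M" "L (t - s) \<in> borel_measurable M"
    using st by auto
  have "expectation (\<lambda>\<omega>. g (L t \<omega> - L s \<omega>)) = (LINT y|distr M borel (\<lambda>\<omega>. L t \<omega> - L s \<omega>). g y)"
    by (simp add: integral_distr)
  also have "\<dots> = expectation (\<lambda>\<omega>. g (L (t - s) \<omega>))"
    unfolding distr_increment[OF st] by (simp add: integral_distr)
  finally show ?thesis .
qed

lemma prob_large_increment:
  assumes st: "0 \<le> s" "s \<le> t"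
  shows "prob {\<omega> \<in> space M. 1 < \<bar>L t \<omega> - L s \<omega>\<bar>} \<le> K * (t - s)"
proof -
  have [measurable]: "L t \<in> borel_measurable M" "L s \<in> borel_measurable M" "L (t - s) \<in> borel_measurable M"
    using st by auto
  have "prob {\<omega> \<in> space M. 1 < \<bar>L t \<omega> - L s \<omega>\<bar>}
      = measure (distr M borel (\<lambda>\<omega>. L t \<omega> - L s \<omega>)) {y. 1 < \<bar>y\<bar>}"
    by (subst measure_distr) (auto intro!: arg_cong[where f = prob])
  also have "\<dots> = prob {\<omega> \<in> space M. 1 < \<bar>L (t - s) \<omega>\<bar>}"
    unfolding distr_increment[OF st]
    by (subst measure_distr) (auto intro!: arg_cong[where f = prob])
  finally show ?thesis using tail_rate[of "t - s"] st by simp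
qed

text \<open>Takes the place of conditioning on \<open>F s\<close>. Independence is given for
  \<open>\<sigma>\<close>-algebras; those generated by \<open>Y\<close> and by \<open>g\<close> of
  the increment are contained in them. The bounds provide the integrability for the product
  formula.\<close>

lemma expectation_past_times_increment:
  fixes g :: "real \<Rightarrow> real"
  assumes g [measurable]: "g \<in> borel_measurable borel" and g_bound: "\<And>y. \<bar>g y\<bar> \<le> C"
    and st: "0 \<le> s" "s \<le> t"
    and Y: "Y \<in> borel_measurable (F s)" and Y_bound: "\<And>\<omega>. \<omega> \<in> space M \<Longrightarrow> \<bar>Y \<omega>\<bar> \<le> B"
  shows "expectation (\<lambda>\<omega>. Y \<omega> * g (L t \<omega> - L s \<omega>)) = expectation Y * expectation (\<lambda>\<omega>. g (L (t - s) \<omega>))"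
proof -
  have [measurable]: "L t \<in> borel_measurable M" "L s \<in> borel_measurable M" "Y \<in> borel_measurable M"
    using st Y borel_measurable_F_imp_M by auto
  let ?D = "\<lambda>\<omega>. L t \<omega> - L s \<omega>"
  have "indep_set (sets (F s)) (sets (vimage_algebra (space M) ?D borel))"
    using levy st by (auto simp: levy_process_def)
  then have "indep_var borel Y borel (\<lambda>\<omega>. g (?D \<omega>))"
    unfolding indep_var_eq
  proof (intro conjI)
    assume ind: "indep_set (sets (F s)) (sets (vimage_algebra (space M) ?D borel))"
    have 1: "sigma_sets (space M) {Y -` A \<inter> space M |A. A \<in> sets borel} \<subseteq> sets (F s)"
      using measurable_sets[OF Y] by (subst space_F[of s, symmetric]) (intro sets.sigma_sets_subset, auto simp: space_F)
    have 2: "sigma_sets (space M) {(\<lambda>\<omega>. g (?D \<omega>)) -` A \<inter> space M |A. A \<in> sets borel}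
        \<subseteq> sets (vimage_algebra (space M) ?D borel)"
    proof -
      have "(\<lambda>\<omega>. g (?D \<omega>)) \<in> borel_measurable (vimage_algebra (space M) ?D borel)"
        by (rule measurable_compose[OF measurable_vimage_algebra1 g]) auto
      from measurable_sets[OF this]
      have "{(\<lambda>\<omega>. g (?D \<omega>)) -` A \<inter> space M |A. A \<in> sets borel} \<subseteq> sets (vimage_algebra (space M) ?D borel)"
        by auto
      then show ?thesis using sets.sigma_sets_subset[of _ "vimage_algebra (space M) ?D borel"] by simp
    qed
    show "indep_set (sigma_sets (space M) {Y -` A \<inter> space M |A. A \<in> sets borel})
        (sigma_sets (space M) {(\<lambda>\<omega>. g (?D \<omega>)) -` A \<inter> space M |A. A \<in> sets borel})"
      unfolding indep_set_def
      by (rule indep_sets_mono_sets[OF ind[unfolded indep_set_def]]) (use 1 2 in \<open>simp split: bool.split\<close>)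
  qed simp_all
  moreover have "integrable M Y" "integrable M (\<lambda>\<omega>. g (?D \<omega>))"
    using Y_bound g_bound by (auto intro!: integrable_bounded)
  ultimately have "expectation (\<lambda>\<omega>. Y \<omega> * g (?D \<omega>)) = expectation Y * expectation (\<lambda>\<omega>. g (?D \<omega>))"
    by (intro indep_var_lebesgue_integral)
  then show ?thesis by (simp add: expectation_increment[OF g st])
qed

lemma truncated_riemann_sum_measurable:
  assumes "adapted F D" "0 \<le> h" "k \<le> n"
  shows "truncated_riemann_sum D L h k \<in> borel_measurable (F (h * real n))"
proof -
  have m: "D (h * real j) \<in> borel_measurable (F (h * real n))"
    "L (h * real j) \<in> borel_measurable (F (h * real n))" if "j \<le> n" for j
  proof -
    have "0 \<le> h * real j" "h * real j \<le> h * real n"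
      using that \<open>0 \<le> h\<close> by (auto intro: mult_left_mono)
    then show "D (h * real j) \<in> borel_measurable (F (h * real n))"
      "L (h * real j) \<in> borel_measurable (F (h * real n))"
      using assms(1) L_adapted borel_measurable_F_mono unfolding adapted_def by blast+
  qed
  show ?thesis unfolding truncated_riemann_sum_def[abs_def]
    by (intro borel_measurable_sum borel_measurable_times measurable_compose[OF _ small_part_measurable]
        borel_measurable_diff m) (use \<open>k \<le> n\<close> in auto)
qed

lemma riemann_sum_measurable:
  assumes "adapted F D" "0 \<le> h"
  shows "riemann_sum D L h n \<in> borel_measurable M"
proof -
  have [measurable]: "D (h * real j) \<in> borel_measurable M" "L (h * real j) \<in> borel_measurable M" for j
    using assms adapted_imp_measurable by auto
  show ?thesis unfolding riemann_sum_def[abs_def] by measurable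
qed

text \<open>A crude bound growing with \<open>n\<close>, used only to make squares
  integrable.\<close>

lemma truncated_riemann_sum_bound:
  assumes "\<And>s \<omega>. 0 \<le> s \<Longrightarrow> \<omega> \<in> space M \<Longrightarrow> \<bar>D s \<omega>\<bar> \<le> B" and "0 \<le> h" "\<omega> \<in> space M"
  shows "\<bar>truncated_riemann_sum D L h n \<omega>\<bar> \<le> real n * B"
proof -
  have B: "0 \<le> B" using assms(1)[of 0 \<omega>] assms by (auto intro: order_trans[OF abs_ge_zero])
  have "\<bar>truncated_riemann_sum D L h n \<omega>\<bar>
      \<le> (\<Sum>j<n. \<bar>D (h * real j) \<omega> * small_part (L (h * real (Suc j)) \<omega> - L (h * real j) \<omega>)\<bar>)"
    unfolding truncated_riemann_sum_def by (rule sum_abs)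
  also have "\<dots> \<le> (\<Sum>j<n. B * 1)"
    unfolding abs_mult using assms abs_small_part_le B by (intro sum_mono mult_mono) auto
  finally show ?thesis by simp
qed

text \<open>A discrete Gronwall argument. Expanding the square of the sum after one more cell gives
  a cross term with the mean of a truncated increment and a diagonal term with its second moment,
  both factored by independence and both at most \<open>K * h\<close> times a moment of the
  past.\<close>

lemma truncated_riemann_sum_second_moment:
  assumes D: "adapted F D" and D_bound: "\<And>s \<omega>. 0 \<le> s \<Longrightarrow> \<omega> \<in> space M \<Longrightarrow> \<bar>D s \<omega>\<bar> \<le> B"
    and h: "0 \<le> h"
  shows "expectation (\<lambda>\<omega>. (truncated_riemann_sum D L h n \<omega>)\<^sup>2)
    \<le> (1 + K * h) ^ n * (2 * K * h * (\<Sum>j<n. expectation (\<lambda>\<omega>. (D (h * real j) \<omega>)\<^sup>2)))"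
proof (induction n)
  case 0
  then show ?case by (simp add: truncated_riemann_sum_def)
next
  case (Suc n)
  let ?s = "h * real n" and ?t = "h * real (Suc n)"
  let ?N = "truncated_riemann_sum D L h n" and ?\<xi> = "\<lambda>\<omega>. L ?t \<omega> - L ?s \<omega>"
  have st: "0 \<le> ?s" "?s \<le> ?t" "?t - ?s = h" using h by (auto simp: algebra_simps)
  have Ds: "D ?s \<in> borel_measurable (F ?s)" using D st by (auto simp: adapted_def)
  have Ns: "?N \<in> borel_measurable (F ?s)" by (rule truncated_riemann_sum_measurable[OF D h]) simp
  have [measurable]: "D ?s \<in> borel_measurable M" "?N \<in> borel_measurable M"
    "L ?t \<in> borel_measurable M" "L ?s \<in> borel_measurable M"
    using borel_measurable_F_imp_M[OF Ds] borel_measurable_F_imp_M[OF Ns] st L_measurable[of ?t] L_measurable[of ?s]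
    by (simp_all del: of_nat_Suc)
  have B: "0 \<le> B"
  proof -
    obtain \<omega> where "\<omega> \<in> space M" using not_empty by blast
    from D_bound[OF order_refl this] show ?thesis by (rule order_trans[OF abs_ge_zero])
  qed
  have N_bound: "\<bar>?N \<omega>\<bar> \<le> real n * B" if "\<omega> \<in> space M" for \<omega>
    by (rule truncated_riemann_sum_bound[OF D_bound h that])
  have D1: "\<bar>D ?s \<omega>\<bar> \<le> B" if "\<omega> \<in> space M" for \<omega> using D_bound st that by auto
  have ND_bound: "\<bar>?N \<omega> * D ?s \<omega>\<bar> \<le> real n * B * B" if "\<omega> \<in> space M" for \<omega>
    unfolding abs_mult using N_bound D1 that B by (intro mult_mono) auto
  have D2_bound: "\<bar>(D ?s \<omega>)\<^sup>2\<bar> \<le> B\<^sup>2" if "\<omega> \<in> space M" for \<omega>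
    using power_mono[OF D1[OF that], of 2] by simp
  have N2_bound: "\<bar>(?N \<omega>)\<^sup>2\<bar> \<le> (real n * B)\<^sup>2" if "\<omega> \<in> space M" for \<omega>
    using power_mono[OF N_bound[OF that], of 2] by simp
  have sq_le_1: "\<bar>(small_part y)\<^sup>2\<bar> \<le> 1" for y
    using abs_small_part_le[of y] by (simp add: abs_square_le_1)
  have iN: "integrable M (\<lambda>\<omega>. (?N \<omega>)\<^sup>2)" by (rule integrable_bounded[OF _ N2_bound]) measurable
  have iD: "integrable M (\<lambda>\<omega>. (D ?s \<omega>)\<^sup>2)" by (rule integrable_bounded[OF _ D2_bound]) measurable
  have iND: "integrable M (\<lambda>\<omega>. ?N \<omega> * D ?s \<omega>)" by (rule integrable_bounded[OF _ ND_bound]) measurable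
  have i1: "integrable M (\<lambda>\<omega>. (?N \<omega> * D ?s \<omega>) * small_part (?\<xi> \<omega>))"
  proof (rule integrable_bounded)
    show "\<bar>(?N \<omega> * D ?s \<omega>) * small_part (?\<xi> \<omega>)\<bar> \<le> real n * B * B * 1" if "\<omega> \<in> space M" for \<omega>
      unfolding abs_mult[of "?N \<omega> * D ?s \<omega>"]
      by (rule mult_mono[OF ND_bound[OF that] abs_small_part_le]) (use B in auto)
  qed measurable
  have i2: "integrable M (\<lambda>\<omega>. (D ?s \<omega>)\<^sup>2 * (small_part (?\<xi> \<omega>))\<^sup>2)"
  proof (rule integrable_bounded)
    show "\<bar>(D ?s \<omega>)\<^sup>2 * (small_part (?\<xi> \<omega>))\<^sup>2\<bar> \<le> B\<^sup>2 * 1" if "\<omega> \<in> space M" for \<omega>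
      unfolding abs_mult by (rule mult_mono[OF D2_bound[OF that] sq_le_1]) auto
  qed measurable
  let ?EN = "expectation (\<lambda>\<omega>. (?N \<omega>)\<^sup>2)" and ?ED = "expectation (\<lambda>\<omega>. (D ?s \<omega>)\<^sup>2)"
  have EN: "0 \<le> ?EN" and ED: "0 \<le> ?ED" by simp_all
  have cross: "expectation (\<lambda>\<omega>. (?N \<omega> * D ?s \<omega>) * small_part (?\<xi> \<omega>))
      = expectation (\<lambda>\<omega>. ?N \<omega> * D ?s \<omega>) * expectation (\<lambda>\<omega>. small_part (L h \<omega>))"
    using expectation_past_times_increment[OF small_part_measurable abs_small_part_le st(1,2)
        borel_measurable_times[OF Ns Ds] ND_bound] unfolding st(3) .
  have diag: "expectation (\<lambda>\<omega>. (D ?s \<omega>)\<^sup>2 * (small_part (?\<xi> \<omega>))\<^sup>2)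
      = ?ED * expectation (\<lambda>\<omega>. (small_part (L h \<omega>))\<^sup>2)"
    using expectation_past_times_increment[OF borel_measurable_power[OF small_part_measurable] sq_le_1 st(1,2)
        borel_measurable_power[OF Ds] D2_bound] unfolding st(3) .
  \<comment> \<open>Splitting the cross term this way puts half of it into the growth factor
    \<open>1 + K * h\<close>; the other half doubles the diagonal term, which explains the factor 2
    in the claim.\<close>
  have ND: "2 * \<bar>expectation (\<lambda>\<omega>. ?N \<omega> * D ?s \<omega>)\<bar> \<le> ?EN + ?ED"
  proof -
    have "2 * \<bar>expectation (\<lambda>\<omega>. ?N \<omega> * D ?s \<omega>)\<bar> \<le> 2 * expectation (\<lambda>\<omega>. \<bar>?N \<omega> * D ?s \<omega>\<bar>)"
      by (intro mult_left_mono integral_abs_bound) auto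
    also have "\<dots> = expectation (\<lambda>\<omega>. 2 * \<bar>?N \<omega> * D ?s \<omega>\<bar>)" by simp
    also have "\<dots> \<le> expectation (\<lambda>\<omega>. (?N \<omega>)\<^sup>2 + (D ?s \<omega>)\<^sup>2)"
    proof (intro integral_mono)
      show "2 * \<bar>?N \<omega> * D ?s \<omega>\<bar> \<le> (?N \<omega>)\<^sup>2 + (D ?s \<omega>)\<^sup>2" for \<omega>
        using sum_squares_bound[of "\<bar>?N \<omega>\<bar>" "\<bar>D ?s \<omega>\<bar>"] by (simp add: abs_mult)
    qed (use iN iD iND in auto)
    also have "\<dots> = ?EN + ?ED" using iN iD by simp
    finally show ?thesis .
  qed
  have step: "(truncated_riemann_sum D L h (Suc n) \<omega>)\<^sup>2
      = (?N \<omega>)\<^sup>2 + 2 * ((?N \<omega> * D ?s \<omega>) * small_part (?\<xi> \<omega>)) + (D ?s \<omega>)\<^sup>2 * (small_part (?\<xi> \<omega>))\<^sup>2" for \<omega>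
  proof -
    have "truncated_riemann_sum D L h (Suc n) \<omega> = ?N \<omega> + D ?s \<omega> * small_part (?\<xi> \<omega>)"
      by (simp only: truncated_riemann_sum_def sum.lessThan_Suc)
    then show ?thesis by (simp only: power2_sum power_mult_distrib mult.assoc add.assoc add.commute add.left_commute)
  qed
  have "expectation (\<lambda>\<omega>. (truncated_riemann_sum D L h (Suc n) \<omega>)\<^sup>2)
      = ?EN + 2 * expectation (\<lambda>\<omega>. (?N \<omega> * D ?s \<omega>) * small_part (?\<xi> \<omega>))
        + expectation (\<lambda>\<omega>. (D ?s \<omega>)\<^sup>2 * (small_part (?\<xi> \<omega>))\<^sup>2)"
    unfolding step
    by (simp only: Bochner_Integration.integral_add[OF Bochner_Integration.integrable_add[OF iN integrable_mult_right[OF i1]] i2]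
        Bochner_Integration.integral_add[OF iN integrable_mult_right[OF i1]] integral_mult_right_zero)
  also have "\<dots> = ?EN + 2 * (expectation (\<lambda>\<omega>. ?N \<omega> * D ?s \<omega>) * expectation (\<lambda>\<omega>. small_part (L h \<omega>)))
      + ?ED * expectation (\<lambda>\<omega>. (small_part (L h \<omega>))\<^sup>2)"
    by (simp only: cross diag)
  also have "\<dots> \<le> ?EN + (?EN + ?ED) * (K * h) + ?ED * (K * h)"
  proof (intro add_mono order_refl mult_left_mono[OF square_rate[OF h] ED])
    have "2 * (expectation (\<lambda>\<omega>. ?N \<omega> * D ?s \<omega>) * expectation (\<lambda>\<omega>. small_part (L h \<omega>)))
        \<le> (2 * \<bar>expectation (\<lambda>\<omega>. ?N \<omega> * D ?s \<omega>)\<bar>) * \<bar>expectation (\<lambda>\<omega>. small_part (L h \<omega>))\<bar>"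
      using abs_ge_self[of "expectation (\<lambda>\<omega>. ?N \<omega> * D ?s \<omega>) * expectation (\<lambda>\<omega>. small_part (L h \<omega>))"]
      by (simp only: abs_mult mult.assoc)
    also have "\<dots> \<le> (?EN + ?ED) * (K * h)"
      by (intro mult_mono ND mean_rate[OF h]) (use EN ED in auto)
    finally show "2 * (expectation (\<lambda>\<omega>. ?N \<omega> * D ?s \<omega>) * expectation (\<lambda>\<omega>. small_part (L h \<omega>))) \<le> (?EN + ?ED) * (K * h)" .
  qed
  also have "\<dots> = (1 + K * h) * ?EN + 2 * K * h * ?ED" by (simp only: distrib_right distrib_left) simp
  \<comment> \<open>The newest term is enlarged by \<open>(1 + K * h) ^ Suc n\<close>, which is at
    least 1, so that all terms share one factor and the induction closes.\<close>
  also have "\<dots> \<le> (1 + K * h) * ((1 + K * h) ^ n * (2 * K * h * (\<Sum>j<n. expectation (\<lambda>\<omega>. (D (h * real j) \<omega>)\<^sup>2))))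
      + (1 + K * h) ^ Suc n * (2 * K * h * ?ED)"
  proof (intro add_mono mult_left_mono Suc.IH)
    have "1 * (2 * K * h * ?ED) \<le> (1 + K * h) ^ Suc n * (2 * K * h * ?ED)"
      using K_nonneg h ED by (intro mult_right_mono one_le_power) auto
    then show "2 * K * h * ?ED \<le> (1 + K * h) ^ Suc n * (2 * K * h * ?ED)" by simp
  qed (use K_nonneg h in auto)
  also have "\<dots> = (1 + K * h) ^ Suc n * (2 * K * h * (\<Sum>j<Suc n. expectation (\<lambda>\<omega>. (D (h * real j) \<omega>)\<^sup>2)))"
    by (simp only: power_Suc sum.lessThan_Suc distrib_left mult.assoc)
  finally show ?case .
qed

text \<open>A union bound over cells: \<open>n\<close> times \<open>K * h\<close> depends on the
  total length \<open>h * n\<close> and not on the mesh.\<close>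

lemma prob_large_increment_grid:
  assumes "0 \<le> h"
  shows "prob {\<omega> \<in> space M. \<exists>j<n. 1 < \<bar>L (h * real (Suc j)) \<omega> - L (h * real j) \<omega>\<bar>} \<le> K * (h * real n)"
proof -
  have [measurable]: "L (h * real j) \<in> borel_measurable M" for j using assms by auto
  have "prob {\<omega> \<in> space M. \<exists>j<n. 1 < \<bar>L (h * real (Suc j)) \<omega> - L (h * real j) \<omega>\<bar>}
      = prob (\<Union>j<n. {\<omega> \<in> space M. 1 < \<bar>L (h * real (Suc j)) \<omega> - L (h * real j) \<omega>\<bar>})"
    by (intro arg_cong[where f = prob]) auto
  also have "\<dots> \<le> (\<Sum>j<n. prob {\<omega> \<in> space M. 1 < \<bar>L (h * real (Suc j)) \<omega> - L (h * real j) \<omega>\<bar>})"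
    by (intro finite_measure_subadditive_finite) (auto simp del: of_nat_Suc)
  also have "\<dots> \<le> (\<Sum>j<n. K * h)"
  proof (intro sum_mono)
    fix j
    show "prob {\<omega> \<in> space M. 1 < \<bar>L (h * real (Suc j)) \<omega> - L (h * real j) \<omega>\<bar>} \<le> K * h"
      using prob_large_increment[of "h * real j" "h * real (Suc j)"] assms by (simp add: algebra_simps)
  qed
  finally show ?thesis by (simp add: algebra_simps)
qed

lemma riemann_sum_eq_truncated:
  assumes "\<not> (\<exists>j<n. 1 < \<bar>L (h * real (Suc j)) \<omega> - L (h * real j) \<omega>\<bar>)"
  shows "riemann_sum D L h n \<omega> = truncated_riemann_sum D L h n \<omega>"
  using assms unfolding riemann_sum_def truncated_riemann_sum_def
  by (intro sum.cong) (auto simp: small_part_def)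

text \<open>\<open>(1 + K * h) ^ n\<close> is at most \<open>exp (K * h * n)\<close>, hence at most
  \<open>exp K\<close> on a horizon of length 1, uniformly in the mesh.\<close>

lemma truncated_riemann_sum_second_moment_le:
  assumes D: "adapted F D" and D_bound: "\<And>s \<omega>. 0 \<le> s \<Longrightarrow> \<omega> \<in> space M \<Longrightarrow> \<bar>D s \<omega>\<bar> \<le> B"
    and h: "0 \<le> h" and hn: "h * real n \<le> 1"
    and c: "\<And>j. j < n \<Longrightarrow> expectation (\<lambda>\<omega>. (D (h * real j) \<omega>)\<^sup>2) \<le> c" "0 \<le> c"
  shows "expectation (\<lambda>\<omega>. (truncated_riemann_sum D L h n \<omega>)\<^sup>2) \<le> 2 * K * exp K * (h * real n) * c"
proof -
  have "(1 + K * h) ^ n \<le> exp (K * h) ^ n"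
    using K_nonneg h exp_ge_add_one_self[of "K * h"] by (intro power_mono) auto
  also have "\<dots> = exp (K * (h * real n))" by (simp add: exp_of_nat_mult[symmetric] algebra_simps)
  also have "\<dots> \<le> exp K" using hn K_nonneg mult_left_mono[of "h * real n" 1 K] by simp
  finally have e: "(1 + K * h) ^ n \<le> exp K" .
  have "(\<Sum>j<n. expectation (\<lambda>\<omega>. (D (h * real j) \<omega>)\<^sup>2)) \<le> real n * c"
    using c sum_bounded_above[of "{..<n}" "\<lambda>j. expectation (\<lambda>\<omega>. (D (h * real j) \<omega>)\<^sup>2)" c] by simp
  then have "(1 + K * h) ^ n * (2 * K * h * (\<Sum>j<n. expectation (\<lambda>\<omega>. (D (h * real j) \<omega>)\<^sup>2)))
      \<le> exp K * (2 * K * h * (real n * c))"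
    using K_nonneg h by (intro mult_mono e mult_left_mono mult_nonneg_nonneg sum_nonneg) auto
  then show ?thesis using truncated_riemann_sum_second_moment[OF D D_bound h, of n]
    by (simp add: algebra_simps)
qed

text \<open>Either some increment exceeds 1, or the sum equals its truncation and Chebyshev's
  inequality applies. Only the second contribution reflects the size of the coefficients; the first
  is always of order \<open>h * n\<close>.\<close>

lemma prob_riemann_sum_gt:
  assumes D: "adapted F D" and D_bound: "\<And>s \<omega>. 0 \<le> s \<Longrightarrow> \<omega> \<in> space M \<Longrightarrow> \<bar>D s \<omega>\<bar> \<le> B"
    and h: "0 \<le> h" and hn: "h * real n \<le> 1"
    and c: "\<And>j. j < n \<Longrightarrow> expectation (\<lambda>\<omega>. (D (h * real j) \<omega>)\<^sup>2) \<le> c" "0 \<le> c"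
    and "0 < \<eta>"
  shows "prob {\<omega> \<in> space M. \<eta> < \<bar>riemann_sum D L h n \<omega>\<bar>}
    \<le> K * (h * real n) + 2 * K * exp K * (h * real n) * c / \<eta>\<^sup>2"
proof -
  let ?N = "truncated_riemann_sum D L h n"
  have [measurable]: "?N \<in> borel_measurable M"
    by (rule borel_measurable_F_imp_M[OF truncated_riemann_sum_measurable[OF D h order_refl]]) (use h in auto)
  have [measurable]: "riemann_sum D L h n \<in> borel_measurable M" by (rule riemann_sum_measurable[OF D h])
  have [measurable]: "L (h * real j) \<in> borel_measurable M" for j using h by auto
  let ?J = "{\<omega> \<in> space M. \<exists>j<n. 1 < \<bar>L (h * real (Suc j)) \<omega> - L (h * real j) \<omega>\<bar>}"
  let ?T = "{\<omega> \<in> space M. \<eta>\<^sup>2 \<le> (?N \<omega>)\<^sup>2}"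
  have "prob {\<omega> \<in> space M. \<eta> < \<bar>riemann_sum D L h n \<omega>\<bar>} \<le> prob (?J \<union> ?T)"
  proof (intro finite_measure_mono subsetI)
    fix \<omega> assume \<omega>: "\<omega> \<in> {\<omega> \<in> space M. \<eta> < \<bar>riemann_sum D L h n \<omega>\<bar>}"
    show "\<omega> \<in> ?J \<union> ?T"
    proof (cases "\<omega> \<in> ?J")
      case False
      then have "riemann_sum D L h n \<omega> = ?N \<omega>" using \<omega> by (intro riemann_sum_eq_truncated) auto
      then have "\<eta>\<^sup>2 \<le> (?N \<omega>)\<^sup>2" using \<omega> \<open>0 < \<eta>\<close> by (intro abs_le_square_iff[THEN iffD1]) auto
      then show ?thesis using \<omega> by auto
    qed simp
  qed measurable
  also have "\<dots> \<le> prob ?J + prob ?T" by (intro measure_Un_le) measurable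
  also have "prob ?J \<le> K * (h * real n)" by (rule prob_large_increment_grid[OF h])
  also have "prob ?T \<le> expectation (\<lambda>\<omega>. (?N \<omega>)\<^sup>2) / \<eta>\<^sup>2"
  proof (rule integral_Markov_inequality_measure[where A = "{}"])
    have "\<bar>(?N \<omega>)\<^sup>2\<bar> \<le> (real n * B)\<^sup>2" if "\<omega> \<in> space M" for \<omega>
      using power_mono[OF truncated_riemann_sum_bound[OF D_bound h that, where n = n], where n = 2] by simp
    then show "integrable M (\<lambda>\<omega>. (?N \<omega>)\<^sup>2)" by (intro integrable_bounded) measurable
  qed (use \<open>0 < \<eta>\<close> in auto)
  also have "\<dots> \<le> 2 * K * exp K * (h * real n) * c / \<eta>\<^sup>2"
    by (intro divide_right_mono truncated_riemann_sum_second_moment_le[OF D D_bound h hn c]) auto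
  finally show ?thesis by simp
qed

end

section \<open>Elementary integrals as limits of Riemann sums\<close>

text \<open>\<open>nat \<lceil>a / h\<rceil>\<close> is the first grid index whose time is not
  before \<open>a\<close>. The indicator keeps exactly the earlier cells, so the sum ends at that
  grid point, or at the last one if it comes sooner.\<close>

lemma sum_increments_before_telescope:
  fixes g :: "real \<Rightarrow> real"
  assumes "0 < h"
  shows "(\<Sum>j<n. indicator {..<a} (h * real j) * (g (h * real (Suc j)) - g (h * real j)))
    = g (h * real (min n (nat \<lceil>a / h\<rceil>))) - g 0"
proof -
  have "h * real j < a \<longleftrightarrow> j < nat \<lceil>a / h\<rceil>" for j
    using assms by (simp add: zless_nat_eq_int_zless less_ceiling_iff pos_less_divide_eq mult.commute)
  then have "(\<Sum>j<n. indicator {..<a} (h * real j) * (g (h * real (Suc j)) - g (h * real j)))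
      = (\<Sum>j<n. if j < nat \<lceil>a / h\<rceil> then g (h * real (Suc j)) - g (h * real j) else 0)"
    by (intro sum.cong) (auto simp: indicator_def)
  also have "\<dots> = (\<Sum>j<min n (nat \<lceil>a / h\<rceil>). g (h * real (Suc j)) - g (h * real j))"
    by (subst sum.inter_filter[symmetric]) (auto intro!: sum.cong)
  also have "\<dots> = g (h * real (min n (nat \<lceil>a / h\<rceil>))) - g (h * real 0)"
    by (rule sum_lessThan_telescope)
  finally show ?thesis by simp
qed

text \<open>If \<open>t \<le> a\<close>, the sum ends exactly at \<open>t\<close> for every positive
  \<open>n\<close>. Otherwise it ends at a grid point between \<open>a\<close> and
  \<open>a + t / n\<close>, so \<open>a\<close> is approached from the right and right continuity
  suffices.\<close>

lemma sum_increments_before_tendsto: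
  fixes g :: "real \<Rightarrow> real"
  assumes g: "\<And>s. 0 \<le> s \<Longrightarrow> continuous (at_right s) g" and "0 \<le> a" "0 < t"
  shows "(\<lambda>n. \<Sum>j<n. indicator {..<a} (t / real n * real j) *
      (g (t / real n * real (Suc j)) - g (t / real n * real j))) \<longlonglongrightarrow> g (min t a) - g 0"
proof -
  define m where "m n = t / real n * real (min n (nat \<lceil>a / (t / real n)\<rceil>))" for n :: nat
  have "(\<lambda>n. g (m n)) \<longlonglongrightarrow> g (min t a)"
  proof (cases "t \<le> a")
    case True
    have "m n = t" if "0 < n" for n
    proof -
      have "real n \<le> a / (t / real n)" using True that \<open>0 < t\<close> by (simp add: field_simps)
      then have "real n \<le> real_of_int \<lceil>a / (t / real n)\<rceil>" by (rule order_trans[OF _ le_of_int_ceiling])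
      then have "n \<le> nat \<lceil>a / (t / real n)\<rceil>" by linarith
      then show ?thesis using that by (simp add: m_def)
    qed
    then have "eventually (\<lambda>n. g (m n) = g (min t a)) sequentially"
      using True by (intro eventually_sequentiallyI[of 1]) auto
    then show ?thesis by (rule tendsto_eventually)
  next
    case False
    have bounds: "a \<le> m n" "m n \<le> a + t / real n" if "0 < n" for n
    proof -
      define h where "h = t / real n"
      have h: "0 < h" "h * real n = t" using that \<open>0 < t\<close> by (auto simp: h_def)
      have c: "a / h \<le> real (nat \<lceil>a / h\<rceil>)" "real (nat \<lceil>a / h\<rceil>) \<le> a / h + 1"
        using \<open>0 \<le> a\<close> h by (auto simp: le_of_int_ceiling)
      have "a \<le> h * real (nat \<lceil>a / h\<rceil>)" using c(1) h by (simp add: field_simps)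
      moreover have "h * real (nat \<lceil>a / h\<rceil>) \<le> a + h"
        using mult_left_mono[OF c(2), of h] h by (simp add: distrib_left)
      moreover have "h * real (min n (nat \<lceil>a / h\<rceil>)) \<le> h * real (nat \<lceil>a / h\<rceil>)"
        using h by (intro mult_left_mono) auto
      moreover have "min (h * real n) (h * real (nat \<lceil>a / h\<rceil>)) \<le> h * real (min n (nat \<lceil>a / h\<rceil>))"
        by (simp add: min_def)
      ultimately show "a \<le> m n" "m n \<le> a + t / real n"
        unfolding m_def h_def[symmetric] using False h(2) by linarith+
    qed
    show ?thesis
    proof (rule LIMSEQ_I)
      fix e :: real assume "0 < e"
      have "(g \<longlongrightarrow> g a) (at_right a)" using g[OF \<open>0 \<le> a\<close>] by (simp add: continuous_within)
      then have "eventually (\<lambda>y. dist (g y) (g a) < e) (at_right a)"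
        using \<open>0 < e\<close> by (rule tendstoD)
      then obtain b where b: "b > a" "\<And>y. a < y \<Longrightarrow> y < b \<Longrightarrow> dist (g y) (g a) < e"
        unfolding eventually_at_right_field by auto
      have "(\<lambda>n. t / real n) \<longlonglongrightarrow> 0" by (rule lim_const_over_n)
      then have "eventually (\<lambda>n. t / real n < b - a) sequentially"
        by (rule order_tendstoD) (use b in simp)
      then obtain N where N: "\<And>n. n \<ge> N \<Longrightarrow> t / real n < b - a" by (auto simp: eventually_sequentially)
      have "norm (g (m n) - g (min t a)) < e" if "n \<ge> max 1 N" for n
      proof -
        have n: "0 < n" "N \<le> n" using that by auto
        have "m n = a \<or> a < m n \<and> m n < b" using bounds[OF n(1)] N[OF n(2)] by linarith
        then show ?thesis using b(2)[of "m n"] False \<open>0 < e\<close> by (auto simp: dist_norm min_def)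
      qed
      then show "\<exists>no. \<forall>n\<ge>no. norm (g (m n) - g (min t a)) < e" by blast
    qed
  qed
  then have "(\<lambda>n. g (m n) - g 0) \<longlonglongrightarrow> g (min t a) - g 0" by (intro tendsto_intros)
  then show ?thesis
  proof (rule Lim_transform_eventually)
    show "eventually (\<lambda>n. g (m n) - g 0 = (\<Sum>j<n. indicator {..<a} (t / real n * real j) *
        (g (t / real n * real (Suc j)) - g (t / real n * real j)))) sequentially"
    proof (rule eventually_sequentiallyI[of 1])
      fix n :: nat assume "1 \<le> n"
      then have "0 < t / real n" using \<open>0 < t\<close> by simp
      from sum_increments_before_telescope[OF this, where n = n and a = a and g = g]
      show "g (m n) - g 0 = (\<Sum>j<n. indicator {..<a} (t / real n * real j) *
        (g (t / real n * real (Suc j)) - g (t / real n * real j)))" unfolding m_def by (rule sym)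
    qed
  qed
qed

text \<open>The right limit in time of \<open>simple_value\<close>: intervals \<open>(a, b]\<close>
  become \<open>[a, b)\<close> and the value at time 0 drops out. The right limit of
  \<open>\<sigma>\<close> along the left limits of \<open>X\<close> is
  \<open>\<sigma> (X s)\<close>, so closeness of a simple process to the integrand passes to
  closeness of this function to \<open>\<sigma> (X s)\<close> at grid points.\<close>

definition simple_right_limit :: "'a simple_process \<Rightarrow> real \<Rightarrow> 'a \<Rightarrow> real" where
  "simple_right_limit S s \<omega> =
     (\<Sum>i<len S. coef S i \<omega> * indicator {time S i \<omega>..<time S (Suc i) \<omega>} s)"

lemma simple_predictable_time_nonneg:
  assumes "simple_predictable M F S" "\<omega> \<in> space M" "i \<le> len S"
  shows "0 \<le> time S i \<omega>"
  using assms(3)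
proof (induction i)
  case (Suc i)
  have "time S i \<omega> \<le> time S (Suc i) \<omega>" using assms Suc by (simp add: simple_predictable_def)
  then show ?case using Suc by simp
qed (use assms in \<open>simp add: simple_predictable_def\<close>)

text \<open>The indicator of \<open>[T, T')\<close> is the difference of those of the half-lines
  below \<open>T'\<close> and below \<open>T\<close>. After exchanging the finite sums each
  half-line is covered by \<open>sum_increments_before_tendsto\<close>, pathwise, with random times
  treated as fixed numbers.\<close>

lemma riemann_sum_simple_tendsto:
  assumes S: "simple_predictable M F S" and \<omega>: "\<omega> \<in> space M"
    and Y: "\<And>s. 0 \<le> s \<Longrightarrow> continuous (at_right s) (\<lambda>s. Y s \<omega>)" and "0 < t"
  shows "(\<lambda>n. riemann_sum (simple_right_limit S) Y (t / real n) n \<omega>) \<longlonglongrightarrow> simple_integral S Y t \<omega>"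
proof -
  let ?d = "\<lambda>n j. Y (t / real n * real (Suc j)) \<omega> - Y (t / real n * real j) \<omega>"
  let ?B = "\<lambda>i n. \<Sum>j<n. indicator {..<time S i \<omega>} (t / real n * real j) * ?d n j"
  have B: "?B i \<longlonglongrightarrow> Y (min t (time S i \<omega>)) \<omega> - Y 0 \<omega>" if "i \<le> len S" for i
    using sum_increments_before_tendsto[of "\<lambda>s. Y s \<omega>", OF Y simple_predictable_time_nonneg[OF S \<omega> that] \<open>0 < t\<close>] .
  have eq: "riemann_sum (simple_right_limit S) Y (t / real n) n \<omega>
      = (\<Sum>i<len S. coef S i \<omega> * (?B (Suc i) n - ?B i n))" for n
  proof -
    have ind: "indicator {time S i \<omega>..<time S (Suc i) \<omega>} s
        = (indicator {..<time S (Suc i) \<omega>} s - indicator {..<time S i \<omega>} s :: real)" if "i < len S" for i s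
    proof -
      have "time S i \<omega> \<le> time S (Suc i) \<omega>" using S \<omega> that by (simp add: simple_predictable_def)
      then show ?thesis by (auto simp: indicator_def)
    qed
    have "riemann_sum (simple_right_limit S) Y (t / real n) n \<omega>
        = (\<Sum>j<n. \<Sum>i<len S. coef S i \<omega> *
            (indicator {time S i \<omega>..<time S (Suc i) \<omega>} (t / real n * real j) * ?d n j))"
      unfolding riemann_sum_def simple_right_limit_def by (simp only: sum_distrib_right mult.assoc)
    also have "\<dots> = (\<Sum>i<len S. coef S i \<omega> *
        (\<Sum>j<n. indicator {time S i \<omega>..<time S (Suc i) \<omega>} (t / real n * real j) * ?d n j))"
      by (subst sum.swap) (simp only: sum_distrib_left)
    also have "\<dots> = (\<Sum>i<len S. coef S i \<omega> * (?B (Suc i) n - ?B i n))"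
      by (intro sum.cong refl) (simp add: ind left_diff_distrib sum_subtractf)
    finally show ?thesis .
  qed
  have "(\<lambda>n. \<Sum>i<len S. coef S i \<omega> * (?B (Suc i) n - ?B i n)) \<longlonglongrightarrow>
      (\<Sum>i<len S. coef S i \<omega> * ((Y (min t (time S (Suc i) \<omega>)) \<omega> - Y 0 \<omega>) - (Y (min t (time S i \<omega>)) \<omega> - Y 0 \<omega>)))"
    by (intro tendsto_sum tendsto_mult tendsto_diff tendsto_const B) auto
  then show ?thesis unfolding eq simple_integral_def by simp
qed

lemma simple_value_tendsto_left:
  assumes "0 < s"
  shows "((\<lambda>s. simple_value S s \<omega>) \<longlongrightarrow> simple_value S s \<omega>) (at_left s)"
proof -
  have ind: "((\<lambda>s. indicator {a<..b} s) \<longlongrightarrow> (indicator {a<..b} s :: real)) (at_left s)" for a b :: real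
  proof (rule tendsto_eventually)
    consider "s \<le> a" | "b < s" | "a < s" "s \<le> b" by linarith
    then show "eventually (\<lambda>r. indicator {a<..b} r = (indicator {a<..b} s :: real)) (at_left s)"
    proof cases
      case 1
      then show ?thesis by (intro eventually_at_leftI[of "s - 1"]) (auto simp: indicator_def)
    next
      case 2
      then show ?thesis by (intro eventually_at_leftI[of b]) (auto simp: indicator_def)
    next
      case 3
      then show ?thesis by (intro eventually_at_leftI[of a]) (auto simp: indicator_def)
    qed
  qed
  have ind0: "((\<lambda>s. indicator {0} s) \<longlongrightarrow> (indicator {0} s :: real)) (at_left s)"
    using assms by (intro tendsto_eventually eventually_at_leftI[of 0]) (auto simp: indicator_def)
  show ?thesis unfolding simple_value_def
    by (intro tendsto_add tendsto_mult tendsto_sum tendsto_const ind ind0)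
qed

lemma simple_value_tendsto_right:
  assumes "0 \<le> s"
  shows "((\<lambda>s. simple_value S s \<omega>) \<longlongrightarrow> simple_right_limit S s \<omega>) (at_right s)"
proof -
  have ind: "((\<lambda>s. indicator {a<..b} s) \<longlongrightarrow> (indicator {a..<b} s :: real)) (at_right s)" for a b :: real
  proof (rule tendsto_eventually)
    consider "s < a" | "b \<le> s" | "a \<le> s" "s < b" by linarith
    then show "eventually (\<lambda>r. indicator {a<..b} r = (indicator {a..<b} s :: real)) (at_right s)"
    proof cases
      case 1
      then show ?thesis by (intro eventually_at_rightI[of _ a]) (auto simp: indicator_def)
    next
      case 2
      then show ?thesis by (intro eventually_at_rightI[of _ "s + 1"]) (auto simp: indicator_def)
    next
      case 3
      then show ?thesis by (intro eventually_at_rightI[of _ b]) (auto simp: indicator_def)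
    qed
  qed
  have ind0: "((\<lambda>s. indicator {0} s) \<longlongrightarrow> (0 :: real)) (at_right s)"
    using assms by (intro tendsto_eventually eventually_at_rightI[of _ "s + 1"]) (auto simp: indicator_def)
  have "((\<lambda>s. simple_value S s \<omega>) \<longlongrightarrow> init S \<omega> * 0 + simple_right_limit S s \<omega>) (at_right s)"
    unfolding simple_value_def simple_right_limit_def
    by (intro tendsto_add tendsto_mult tendsto_sum tendsto_const ind ind0)
  then show ?thesis by simp
qed

lemma simple_integral_continuous_right:
  assumes S: "simple_predictable M F S" and \<omega>: "\<omega> \<in> space M"
    and Y: "\<And>s. 0 \<le> s \<Longrightarrow> continuous (at_right s) (\<lambda>s. Y s \<omega>)" and "0 \<le> s"
  shows "continuous (at_right s) (\<lambda>s. simple_integral S Y s \<omega>)"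
proof -
  have "((\<lambda>r. Y (min r c) \<omega>) \<longlongrightarrow> Y (min s c) \<omega>) (at_right s)" for c
  proof (cases "s < c")
    case True
    have "((\<lambda>r. Y r \<omega>) \<longlongrightarrow> Y s \<omega>) (at_right s)" using Y[OF \<open>0 \<le> s\<close>] by (simp add: continuous_within)
    then have "((\<lambda>r. Y (min r c) \<omega>) \<longlongrightarrow> Y s \<omega>) (at_right s)"
      by (rule Lim_transform_eventually) (use True in \<open>intro eventually_at_rightI[of _ c], auto simp: min_def\<close>)
    then show ?thesis using True by (simp add: min_def)
  next
    case False
    then show ?thesis
      by (intro tendsto_eventually eventually_at_rightI[of _ "s + 1"]) (auto simp: min_def)
  qed
  then show ?thesis unfolding continuous_within simple_integral_def
    by (intro tendsto_sum tendsto_mult tendsto_diff tendsto_const)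
qed

section \<open>Measurability of path events and of simple processes\<close>

context filtered_prob_space
begin

text \<open>\<open>N\<close> will be \<open>M\<close> or some \<open>F t\<close>, both of which
  contain all null sets. Path regularity is known only almost surely, so events built from paths are
  first identified up to a null set.\<close>

lemma sets_AE_cong:
  assumes N: "null_sets M \<subseteq> sets N" and A: "A \<in> sets N" "A \<subseteq> space M" and B: "B \<subseteq> space M"
    and ae: "AE \<omega> in M. \<omega> \<in> A \<longleftrightarrow> \<omega> \<in> B"
  shows "B \<in> sets N"
proof -
  have "AE \<omega> in M. \<omega> \<notin> B - A" "AE \<omega> in M. \<omega> \<notin> A - B" using ae by (eventually_elim, auto)+
  then have "B - A \<in> null_sets M" "A - B \<in> null_sets M"
    using A B unfolding null_sets_iff_AE by auto
  then have "A \<union> (B - A) - (A - B) \<in> sets N" using A N by blast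
  also have "A \<union> (B - A) - (A - B) = B" by auto
  finally show ?thesis .
qed

lemma borel_measurable_AE_cong:
  fixes X Y :: "'a \<Rightarrow> real"
  assumes X: "X \<in> borel_measurable M" and ae: "AE \<omega> in M. X \<omega> = Y \<omega>"
  shows "Y \<in> borel_measurable M"
proof (rule measurableI)
  fix A :: "real set" assume A: "A \<in> sets borel"
  show "Y -` A \<inter> space M \<in> sets M"
    by (rule sets_AE_cong[of M "X -` A \<inter> space M"])
      (use measurable_sets[OF X A] ae in \<open>auto elim!: eventually_mono\<close>)
qed simp

text \<open>
  Since \<open>measure\<close> is 0 on non-measurable sets, the assumption \<open>ucp_tendsto\<close> carries information
  only once the error events are known to be measurable.
\<close>

lemma sets_ex_gt_of_countable_dense:
  fixes Y :: "real \<Rightarrow> 'a \<Rightarrow> real"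
  assumes N: "null_sets M \<subseteq> sets N" "space N = space M"
    and Q: "countable Q" "Q \<subseteq> T" and Y: "\<And>s. s \<in> Q \<Longrightarrow> Y s \<in> borel_measurable N"
    and ae: "AE \<omega> in M. \<forall>s\<in>T. \<epsilon> < \<bar>Y s \<omega>\<bar> \<longrightarrow> (\<exists>q\<in>Q. \<epsilon> < \<bar>Y q \<omega>\<bar>)"
  shows "{\<omega> \<in> space M. \<exists>s\<in>T. \<epsilon> < \<bar>Y s \<omega>\<bar>} \<in> sets N"
proof (rule sets_AE_cong[OF N(1)])
  have "(\<Union>q\<in>Q. {\<omega> \<in> space N. \<epsilon> < \<bar>Y q \<omega>\<bar>}) \<in> sets N"
  proof (intro sets.countable_UN' Q(1) image_subsetI)
    fix q assume "q \<in> Q"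
    then have [measurable]: "Y q \<in> borel_measurable N" by (rule Y)
    show "{\<omega> \<in> space N. \<epsilon> < \<bar>Y q \<omega>\<bar>} \<in> sets N" by measurable
  qed
  then show "(\<Union>q\<in>Q. {\<omega> \<in> space M. \<epsilon> < \<bar>Y q \<omega>\<bar>}) \<in> sets N" by (simp add: N(2))
qed (use ae Q(2) in \<open>auto elim!: eventually_mono\<close>)

text \<open>A strict inequality at \<open>s\<close> persists on a right neighbourhood, which
  contains rationals. The endpoint \<open>t\<close> is added to the countable set because no time of
  the interval lies to its right.\<close>

lemma sets_ex_gt_right_continuous:
  fixes Y :: "real \<Rightarrow> 'a \<Rightarrow> real"
  assumes N: "null_sets M \<subseteq> sets N" "space N = space M"
    and Y: "\<And>s. 0 \<le> s \<Longrightarrow> s \<le> t \<Longrightarrow> Y s \<in> borel_measurable N"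
    and ae: "AE \<omega> in M. \<forall>s. 0 \<le> s \<longrightarrow> s < t \<longrightarrow> continuous (at_right s) (\<lambda>s. Y s \<omega>)"
  shows "{\<omega> \<in> space M. \<exists>s\<in>{0..t}. \<epsilon> < \<bar>Y s \<omega>\<bar>} \<in> sets N"
proof (rule sets_ex_gt_of_countable_dense[OF N, where Q = "{0..t} \<inter> insert t \<rat>"])
  show "AE \<omega> in M. \<forall>s\<in>{0..t}. \<epsilon> < \<bar>Y s \<omega>\<bar> \<longrightarrow> (\<exists>q\<in>{0..t} \<inter> insert t \<rat>. \<epsilon> < \<bar>Y q \<omega>\<bar>)"
    using ae
  proof (eventually_elim, intro ballI impI)
    fix \<omega> s assume c: "\<forall>s. 0 \<le> s \<longrightarrow> s < t \<longrightarrow> continuous (at_right s) (\<lambda>s. Y s \<omega>)"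
      and s: "s \<in> {0..t}" "\<epsilon> < \<bar>Y s \<omega>\<bar>"
    show "\<exists>q\<in>{0..t} \<inter> insert t \<rat>. \<epsilon> < \<bar>Y q \<omega>\<bar>"
    proof (cases "s = t")
      case False
      then have "s < t" "0 \<le> s" using s by auto
      then have "((\<lambda>r. \<bar>Y r \<omega>\<bar>) \<longlongrightarrow> \<bar>Y s \<omega>\<bar>) (at_right s)"
        using c by (auto simp: continuous_within intro!: tendsto_rabs)
      then have "eventually (\<lambda>r. \<epsilon> < \<bar>Y r \<omega>\<bar>) (at_right s)" using s(2) by (rule order_tendstoD)
      then obtain b where b: "b > s" "\<And>r. s < r \<Longrightarrow> r < b \<Longrightarrow> \<epsilon> < \<bar>Y r \<omega>\<bar>"
        unfolding eventually_at_right_field by auto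
      obtain q where "q \<in> \<rat>" "s < q" "q < min b t"
        using Rats_dense_in_real[of s "min b t"] b(1) \<open>s < t\<close> by auto
      then show ?thesis using b(2)[of q] \<open>0 \<le> s\<close> by (intro bexI[of _ q]) auto
    qed (use s in auto)
  qed
qed (use Y countable_rat in auto)

lemma sets_ex_gt_left_continuous:
  fixes Y :: "real \<Rightarrow> 'a \<Rightarrow> real"
  assumes N: "null_sets M \<subseteq> sets N" "space N = space M"
    and Y: "\<And>s. 0 \<le> s \<Longrightarrow> s \<le> t \<Longrightarrow> Y s \<in> borel_measurable N"
    and ae: "AE \<omega> in M. \<forall>s. 0 < s \<longrightarrow> s \<le> t \<longrightarrow> continuous (at_left s) (\<lambda>s. Y s \<omega>)"
  shows "{\<omega> \<in> space M. \<exists>s\<in>{0..t}. \<epsilon> < \<bar>Y s \<omega>\<bar>} \<in> sets N"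
proof (rule sets_ex_gt_of_countable_dense[OF N, where Q = "{0..t} \<inter> insert 0 \<rat>"])
  \<comment> \<open>Here the added point is 0, which has no time of the interval on its
    left.\<close>
  show "AE \<omega> in M. \<forall>s\<in>{0..t}. \<epsilon> < \<bar>Y s \<omega>\<bar> \<longrightarrow> (\<exists>q\<in>{0..t} \<inter> insert 0 \<rat>. \<epsilon> < \<bar>Y q \<omega>\<bar>)"
    using ae
  proof (eventually_elim, intro ballI impI)
    fix \<omega> s assume c: "\<forall>s. 0 < s \<longrightarrow> s \<le> t \<longrightarrow> continuous (at_left s) (\<lambda>s. Y s \<omega>)"
      and s: "s \<in> {0..t}" "\<epsilon> < \<bar>Y s \<omega>\<bar>"
    show "\<exists>q\<in>{0..t} \<inter> insert 0 \<rat>. \<epsilon> < \<bar>Y q \<omega>\<bar>"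
    proof (cases "s = 0")
      case False
      then have "0 < s" "s \<le> t" using s by auto
      then have "((\<lambda>r. \<bar>Y r \<omega>\<bar>) \<longlongrightarrow> \<bar>Y s \<omega>\<bar>) (at_left s)"
        using c by (auto simp: continuous_within intro!: tendsto_rabs)
      then have "eventually (\<lambda>r. \<epsilon> < \<bar>Y r \<omega>\<bar>) (at_left s)" using s(2) by (rule order_tendstoD)
      then obtain b where b: "b < s" "\<And>r. b < r \<Longrightarrow> r < s \<Longrightarrow> \<epsilon> < \<bar>Y r \<omega>\<bar>"
        unfolding eventually_at_left_field by auto
      obtain q where "q \<in> \<rat>" "max b 0 < q" "q < s"
        using Rats_dense_in_real[of "max b 0" s] b(1) \<open>0 < s\<close> by auto
      then show ?thesis using b(2)[of q] \<open>s \<le> t\<close> by (intro bexI[of _ q]) auto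
    qed (use s in auto)
  qed
qed (use Y countable_rat in auto)

lemma stopped_coef_measurable:
  fixes c :: "'a \<Rightarrow> real"
  assumes T: "stopping_time F T" and c: "c \<in> borel_measurable (pre_sigma T)"
  shows "(\<lambda>\<omega>. c \<omega> * indicator {\<omega>. T \<omega> \<le> s} \<omega>) \<in> borel_measurable (F s)"
proof (rule borel_measurableI_greater)
  fix a :: real
  have T_set: "{\<omega> \<in> space M. T \<omega> \<le> s} \<in> sets (F s)"
    using stopping_timeD[OF T, of s] by (simp add: pred_def space_F)
  have "{\<omega> \<in> space (pre_sigma T). a < c \<omega>} \<in> sets (pre_sigma T)" using c by measurable
  then have c_set: "{\<omega> \<in> space M. a < c \<omega> \<and> T \<omega> \<le> s} \<in> sets (F s)"
    using sets_pre_sigmaD[OF T, of _ s] by (force simp: space_pre_sigma)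
  show "{\<omega> \<in> space (F s). a < c \<omega> * indicator {\<omega>. T \<omega> \<le> s} \<omega>} \<in> sets (F s)"
  proof (cases "0 \<le> a")
    case True
    then have "{\<omega> \<in> space (F s). a < c \<omega> * indicator {\<omega>. T \<omega> \<le> s} \<omega>} = {\<omega> \<in> space M. a < c \<omega> \<and> T \<omega> \<le> s}"
      by (auto simp: indicator_def space_F split: if_splits)
    then show ?thesis using c_set by simp
  next
    case False
    \<comment> \<open>For negative \<open>a\<close> the event also contains all of
      \<open>T \<omega> > s\<close>, where the product is 0.\<close>
    then have "{\<omega> \<in> space (F s). a < c \<omega> * indicator {\<omega>. T \<omega> \<le> s} \<omega>}
        = {\<omega> \<in> space M. a < c \<omega> \<and> T \<omega> \<le> s} \<union> (space (F s) - {\<omega> \<in> space M. T \<omega> \<le> s})"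
      by (auto simp: indicator_def space_F split: if_splits)
    then show ?thesis using c_set T_set by simp
  qed
qed

lemma simple_right_limit_adapted:
  assumes S: "simple_predictable M F S"
  shows "adapted F (simple_right_limit S)"
  unfolding adapted_def
proof (intro allI impI)
  fix s :: real assume "0 \<le> s"
  have "(\<lambda>\<omega>. coef S i \<omega> * indicator {time S i \<omega>..<time S (Suc i) \<omega>} s) \<in> borel_measurable (F s)"
    if "i < len S" for i
  proof -
    have T: "stopping_time F (time S i)" "stopping_time F (time S (Suc i))"
      and c: "coef S i \<in> borel_measurable (pre_sigma (time S i))"
      using S that by (auto simp: simple_predictable_def)
    have [measurable]: "(\<lambda>\<omega>. coef S i \<omega> * indicator {\<omega>. time S i \<omega> \<le> s} \<omega>) \<in> borel_measurable (F s)"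
      by (rule stopped_coef_measurable[OF T(1) c])
    have [measurable]: "Measurable.pred (F s) (\<lambda>\<omega>. s < time S (Suc i) \<omega>)" by (rule stopping_timeD2[OF T(2)])
    have "(\<lambda>\<omega>. (coef S i \<omega> * indicator {\<omega>. time S i \<omega> \<le> s} \<omega>) * (if s < time S (Suc i) \<omega> then 1 else 0))
        \<in> borel_measurable (F s)" by measurable
    also have "(\<lambda>\<omega>. (coef S i \<omega> * indicator {\<omega>. time S i \<omega> \<le> s} \<omega>) * (if s < time S (Suc i) \<omega> then 1 else 0))
        = (\<lambda>\<omega>. coef S i \<omega> * indicator {time S i \<omega>..<time S (Suc i) \<omega>} s)"
      by (auto simp: indicator_def)
    finally show ?thesis .
  qed
  then show "simple_right_limit S s \<in> borel_measurable (F s)"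
    unfolding simple_right_limit_def[abs_def] by (intro borel_measurable_sum) auto
qed

lemma simple_value_measurable:
  assumes S: "simple_predictable M F S" and s: "0 \<le> s"
  shows "simple_value S s \<in> borel_measurable M"
proof -
  have [measurable]: "init S \<in> borel_measurable M"
    using S borel_measurable_F_imp_M[of _ 0] by (auto simp: simple_predictable_def)
  have "(\<lambda>\<omega>. coef S i \<omega> * indicator {time S i \<omega><..time S (Suc i) \<omega>} s) \<in> borel_measurable M"
    if "i < len S" for i
  proof -
    have T: "stopping_time F (time S i)" "stopping_time F (time S (Suc i))"
      and c: "coef S i \<in> borel_measurable (pre_sigma (time S i))"
      using S that by (auto simp: simple_predictable_def)
    have [measurable]: "(\<lambda>\<omega>. coef S i \<omega> * indicator {\<omega>. time S i \<omega> \<le> s} \<omega>) \<in> borel_measurable M"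
      by (rule borel_measurable_F_imp_M[OF stopped_coef_measurable[OF T(1) c] s])
    have time: "time S j \<in> borel_measurable M" if "stopping_time F (time S j)" for j
    proof (rule borel_measurableI_le)
      fix a :: real
      \<comment> \<open>\<open>F\<close> is known to lie inside \<open>M\<close> only at nonnegative
        times, so a negative level \<open>a\<close> is examined at time 0.\<close>
      have "{\<omega> \<in> space (F (max a 0)). time S j \<omega> \<le> a} \<in> sets (F (max a 0))"
        using stopping_time_le_const[OF that, of a "max a 0"] by (simp add: pred_def)
      then show "{\<omega> \<in> space M. time S j \<omega> \<le> a} \<in> sets M"
        using sets_F_le[of "max a 0"] by (auto simp: space_F)
    qed
    have [measurable]: "time S i \<in> borel_measurable M" "time S (Suc i) \<in> borel_measurable M"
      using time T by auto
    have "(\<lambda>\<omega>. (coef S i \<omega> * indicator {\<omega>. time S i \<omega> \<le> s} \<omega>) *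
        (if time S i \<omega> < s \<and> s \<le> time S (Suc i) \<omega> then 1 else 0)) \<in> borel_measurable M" by measurable
    also have "(\<lambda>\<omega>. (coef S i \<omega> * indicator {\<omega>. time S i \<omega> \<le> s} \<omega>) *
        (if time S i \<omega> < s \<and> s \<le> time S (Suc i) \<omega> then 1 else 0))
        = (\<lambda>\<omega>. coef S i \<omega> * indicator {time S i \<omega><..time S (Suc i) \<omega>} s)"
      by (auto simp: indicator_def)
    finally show ?thesis .
  qed
  then show ?thesis unfolding simple_value_def[abs_def]
    by (intro borel_measurable_add borel_measurable_sum) auto
qed

end

section \<open>Elementary integrals against \<open>L\<close>\<close>

context levy_with_moment_rate
begin

lemma L_right_continuous: "AE \<omega> in M. \<forall>s\<ge>0. continuous (at_right s) (\<lambda>s. L s \<omega>)"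
  using levy by (auto simp: levy_process_def cadlag_def elim!: eventually_mono)

lemma riemann_sum_simple_AE_tendsto:
  assumes S: "simple_predictable M F S" and "0 < t"
  shows "AE \<omega> in M. (\<lambda>n. riemann_sum (simple_right_limit S) L (t / real n) n \<omega>) \<longlonglongrightarrow> simple_integral S L t \<omega>"
  using L_right_continuous AE_space
  by eventually_elim (use riemann_sum_simple_tendsto[OF S _ _ \<open>0 < t\<close>] in auto)

text \<open>Direct measurability of \<open>L\<close> at a stopping time would call for progressive
  measurability. Instead the elementary integral is an almost sure limit of Riemann sums at
  deterministic times, and completeness absorbs the null set.\<close>

lemma simple_integral_measurable:
  assumes S: "simple_predictable M F S" and "0 \<le> t"
  shows "simple_integral S L t \<in> borel_measurable M"
proof (cases "t = 0")
  case True
  have "simple_integral S L 0 \<omega> = 0" if "\<omega> \<in> space M" for \<omega>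
    using simple_predictable_time_nonneg[OF S that] by (auto simp: simple_integral_def min_def)
  then show ?thesis using True by (simp cong: measurable_cong)
next
  case False
  then have t: "0 < t" using \<open>0 \<le> t\<close> by simp
  let ?R = "\<lambda>n. riemann_sum (simple_right_limit S) L (t / real n) n"
  have [measurable]: "?R n \<in> borel_measurable M" for n
    using t by (intro riemann_sum_measurable simple_right_limit_adapted S) auto
  show ?thesis
  proof (rule borel_measurable_AE_cong)
    show "(\<lambda>\<omega>. lim (\<lambda>n. ?R n \<omega>)) \<in> borel_measurable M" by measurable
    show "AE \<omega> in M. lim (\<lambda>n. ?R n \<omega>) = simple_integral S L t \<omega>"
      using riemann_sum_simple_AE_tendsto[OF S t] by eventually_elim (rule limI)
  qed
qed

lemma riemann_sum_simple_prob_tendsto: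
  assumes S: "simple_predictable M F S" and t: "0 < t" and "0 < \<epsilon>"
  shows "(\<lambda>n. prob {\<omega> \<in> space M. \<epsilon> < \<bar>riemann_sum (simple_right_limit S) L (t / real n) n \<omega> - simple_integral S L t \<omega>\<bar>})
    \<longlonglongrightarrow> 0"
proof -
  let ?R = "\<lambda>n. riemann_sum (simple_right_limit S) L (t / real n) n"
  have [measurable]: "?R n \<in> borel_measurable M" for n
    using t by (intro riemann_sum_measurable simple_right_limit_adapted S) auto
  have [measurable]: "simple_integral S L t \<in> borel_measurable M"
    using t by (intro simple_integral_measurable S) auto
  have "(\<lambda>n. \<integral>\<omega>. indicator {\<omega> \<in> space M. \<epsilon> < \<bar>?R n \<omega> - simple_integral S L t \<omega>\<bar>} \<omega> \<partial>M)
      \<longlonglongrightarrow> (\<integral>\<omega>. 0 \<partial>M :: real)"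
  proof (rule integral_dominated_convergence[where w = "\<lambda>_. 1"])
    show "AE \<omega> in M. (\<lambda>n. indicator {\<omega> \<in> space M. \<epsilon> < \<bar>?R n \<omega> - simple_integral S L t \<omega>\<bar>} \<omega>) \<longlonglongrightarrow> (0::real)"
      using riemann_sum_simple_AE_tendsto[OF S t]
    proof eventually_elim
      fix \<omega> assume "(\<lambda>n. ?R n \<omega>) \<longlonglongrightarrow> simple_integral S L t \<omega>"
      then have "eventually (\<lambda>n. dist (?R n \<omega>) (simple_integral S L t \<omega>) < \<epsilon>) sequentially"
        using \<open>0 < \<epsilon>\<close> by (rule tendstoD)
      then have "eventually (\<lambda>n. indicator {\<omega> \<in> space M. \<epsilon> < \<bar>?R n \<omega> - simple_integral S L t \<omega>\<bar>} \<omega> = (0::real)) sequentially"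
        by eventually_elim (auto simp: dist_real_def indicator_def)
      then show "(\<lambda>n. indicator {\<omega> \<in> space M. \<epsilon> < \<bar>?R n \<omega> - simple_integral S L t \<omega>\<bar>} \<omega>) \<longlonglongrightarrow> (0::real)"
        by (rule tendsto_eventually)
    qed
  qed (auto simp: indicator_def)
  then show ?thesis by simp
qed

end

section \<open>The remainder of the linearization\<close>

lemma riemann_sum_diff:
  "riemann_sum (\<lambda>s \<omega>. D s \<omega> - D' s \<omega>) L h n \<omega> = riemann_sum D L h n \<omega> - riemann_sum D' L h n \<omega>"
  unfolding riemann_sum_def by (simp only: left_diff_distrib sum_subtractf)

lemma riemann_sum_cong:
  assumes "\<And>j. j < n \<Longrightarrow> D (h * real j) \<omega> = D' (h * real j) \<omega>"
  shows "riemann_sum D L h n \<omega> = riemann_sum D' L h n \<omega>"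
  unfolding riemann_sum_def using assms by (intro sum.cong) auto

lemma riemann_sum_const: "riemann_sum (\<lambda>_ _. c) L h n \<omega> = c * (L (h * real n) \<omega> - L 0 \<omega>)"
  unfolding riemann_sum_def sum_distrib_left[symmetric]
  using sum_lessThan_telescope[of "\<lambda>j. L (h * real j) \<omega>" n] by simp

text \<open>A left limit at \<open>r > s\<close> is a limit of values at times between
  \<open>s\<close> and \<open>r\<close>, which are already close to the value at \<open>s\<close>.
  Passing to the limit keeps only a weak inequality, hence \<open>e / 2\<close>.\<close>

lemma cadlag_left_limit_tendsto_right:
  fixes \<sigma> :: "real \<Rightarrow> real"
  assumes X: "cadlag (\<lambda>t. X t \<omega>)" and \<sigma>: "continuous_on UNIV \<sigma>" and "0 \<le> s"
  shows "((\<lambda>r. \<sigma> (left_limit X r \<omega>)) \<longlongrightarrow> \<sigma> (X s \<omega>)) (at_right s)"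
proof (rule tendstoI)
  fix e :: real assume "0 < e"
  have \<sigma>c: "isCont \<sigma> y" for y using \<sigma> by (simp add: continuous_on_eq_continuous_at)
  have "((\<lambda>u. X u \<omega>) \<longlongrightarrow> X s \<omega>) (at_right s)" using X \<open>0 \<le> s\<close> by (simp add: cadlag_def continuous_within)
  then have "((\<lambda>u. \<sigma> (X u \<omega>)) \<longlongrightarrow> \<sigma> (X s \<omega>)) (at_right s)" by (rule isCont_tendsto_compose[OF \<sigma>c])
  then have "eventually (\<lambda>u. dist (\<sigma> (X u \<omega>)) (\<sigma> (X s \<omega>)) < e / 2) (at_right s)"
    using \<open>0 < e\<close> by (intro tendstoD) auto
  then obtain b where b: "b > s" "\<And>u. s < u \<Longrightarrow> u < b \<Longrightarrow> dist (\<sigma> (X u \<omega>)) (\<sigma> (X s \<omega>)) < e / 2"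
    unfolding eventually_at_right_field by auto
  have "dist (\<sigma> (left_limit X r \<omega>)) (\<sigma> (X s \<omega>)) < e" if r: "s < r" "r < b" for r
  proof -
    have "0 < r" using r \<open>0 \<le> s\<close> by simp
    then have "\<exists>l. ((\<lambda>u. X u \<omega>) \<longlongrightarrow> l) (at_left r)" using X by (simp add: cadlag_def)
    then obtain l where l: "((\<lambda>u. X u \<omega>) \<longlongrightarrow> l) (at_left r)" by blast
    then have ll: "left_limit X r \<omega> = l"
      using r \<open>0 \<le> s\<close> by (auto simp: left_limit_def intro!: tendsto_Lim)
    have "((\<lambda>u. dist (\<sigma> (X u \<omega>)) (\<sigma> (X s \<omega>))) \<longlongrightarrow> dist (\<sigma> l) (\<sigma> (X s \<omega>))) (at_left r)"
      by (intro tendsto_dist tendsto_const isCont_tendsto_compose[OF \<sigma>c l])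
    moreover have "eventually (\<lambda>u. dist (\<sigma> (X u \<omega>)) (\<sigma> (X s \<omega>)) \<le> e / 2) (at_left r)"
      by (rule eventually_at_leftI[of s]) (use b(2) r in \<open>auto intro: less_imp_le\<close>)
    ultimately have "dist (\<sigma> l) (\<sigma> (X s \<omega>)) \<le> e / 2"
      by (rule tendsto_upperbound) simp
    then show ?thesis using ll \<open>0 < e\<close> by simp
  qed
  then show "eventually (\<lambda>r. dist (\<sigma> (left_limit X r \<omega>)) (\<sigma> (X s \<omega>)) < e) (at_right s)"
    unfolding eventually_at_right_field using b(1) by blast
qed

text \<open>Continuity of \<open>\<sigma>\<close> serves the right limits of the integrand; the
  Lipschitz bound is centred at the starting point and covers the ball in which \<open>X\<close>
  stays before escape.\<close>

locale levy_sde = levy_with_moment_rate M F L K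
  for M :: "'a measure" and F L K +
  fixes \<sigma> :: "real \<Rightarrow> real" and x :: real and X :: "real \<Rightarrow> 'a \<Rightarrow> real" and \<kappa> :: real
  assumes solution: "sde_solution M F \<sigma> L x X"
    and \<sigma>_continuous: "continuous_on UNIV \<sigma>"
    and \<sigma>_lipschitz: "\<And>y. \<bar>y - x\<bar> \<le> 1 \<Longrightarrow> \<bar>\<sigma> y - \<sigma> x\<bar> \<le> \<kappa> * \<bar>y - x\<bar>"
begin

lemma \<kappa>_nonneg: "0 \<le> \<kappa>"
  using \<sigma>_lipschitz[of "x + 1"] by simp

lemma X_adapted: "adapted F X" and X_cadlag: "AE \<omega> in M. cadlag (\<lambda>t. X t \<omega>)"
  using solution by (auto simp: sde_solution_def semimartingale_def)

lemma X_right_continuous: "AE \<omega> in M. \<forall>s\<ge>0. continuous (at_right s) (\<lambda>s. X s \<omega>)"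
  using X_cadlag by (auto simp: cadlag_def elim!: eventually_mono)

lemma X_measurable [measurable]: "0 \<le> t \<Longrightarrow> X t \<in> borel_measurable M"
  by (rule adapted_imp_measurable[OF X_adapted])

lemma \<sigma>_X_adapted: "adapted F (\<lambda>s \<omega>. \<sigma> (X s \<omega>))"
  unfolding adapted_def
  using X_adapted borel_measurable_continuous_onI[OF \<sigma>_continuous]
  by (auto simp: adapted_def intro: measurable_compose)

text \<open>Takes one sequence from the existence clause in the definition of the integral and
  applies the universal clause to it, so that coefficients and integrals converge along the same
  \<open>S\<close>.\<close>

lemma ex_simple_approximation:
  "\<exists>Z S. (\<forall>k. simple_predictable M F (S k))
    \<and> ucp_tendsto M (\<lambda>k. simple_value (S k)) (\<lambda>t \<omega>. \<sigma> (left_limit X t \<omega>))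
    \<and> ucp_tendsto M (\<lambda>k. simple_integral (S k) L) Z
    \<and> adapted F (\<lambda>t \<omega>. \<sigma> (left_limit X t \<omega>)) \<and> (AE \<omega> in M. caglad (\<lambda>t. \<sigma> (left_limit X t \<omega>)))
    \<and> adapted F Z \<and> (AE \<omega> in M. cadlag (\<lambda>t. Z t \<omega>)) \<and> (AE \<omega> in M. \<forall>t\<ge>0. X t \<omega> = x + Z t \<omega>)"
proof -
  obtain Z where Z: "is_stochastic_integral M F (\<lambda>t \<omega>. \<sigma> (left_limit X t \<omega>)) L Z"
    "AE \<omega> in M. \<forall>t\<ge>0. X t \<omega> = x + Z t \<omega>"
    using solution by (auto simp: sde_solution_def)
  then obtain S where "\<forall>k. simple_predictable M F (S k)"
    "ucp_tendsto M (\<lambda>k. simple_value (S k)) (\<lambda>t \<omega>. \<sigma> (left_limit X t \<omega>))"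
    by (auto simp: is_stochastic_integral_def)
  then show ?thesis using Z by (intro exI[of _ Z] exI[of _ S]) (auto simp: is_stochastic_integral_def)
qed

lemma simple_integral_error_sets:
  assumes S: "simple_predictable M F S" and Z: "adapted F Z" "AE \<omega> in M. cadlag (\<lambda>t. Z t \<omega>)" 
  shows "{\<omega> \<in> space M. \<exists>s\<in>{0..t}. \<epsilon> < \<bar>simple_integral S L s \<omega> - Z s \<omega>\<bar>} \<in> sets M"
proof (rule sets_ex_gt_right_continuous)
  show "AE \<omega> in M. \<forall>s. 0 \<le> s \<longrightarrow> s < t \<longrightarrow> continuous (at_right s) (\<lambda>s. simple_integral S L s \<omega> - Z s \<omega>)"
    using L_right_continuous Z(2) AE_space
  proof eventually_elim
    fix \<omega> assume \<omega>: "\<forall>s\<ge>0. continuous (at_right s) (\<lambda>s. L s \<omega>)" "cadlag (\<lambda>t. Z t \<omega>)" "\<omega> \<in> space M"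
    show "\<forall>s. 0 \<le> s \<longrightarrow> s < t \<longrightarrow> continuous (at_right s) (\<lambda>s. simple_integral S L s \<omega> - Z s \<omega>)"
      using simple_integral_continuous_right[OF S \<omega>(3), of L] \<omega>(1,2)
      by (auto simp: cadlag_def intro!: continuous_diff)
  qed
  show "(\<lambda>\<omega>. simple_integral S L s \<omega> - Z s \<omega>) \<in> borel_measurable M" if "0 \<le> s" for s
    using simple_integral_measurable[OF S that] adapted_imp_measurable[OF Z(1) that] by simp
qed auto

lemma simple_value_error_sets:
  assumes S: "simple_predictable M F S" and H: "adapted F H" "AE \<omega> in M. caglad (\<lambda>t. H t \<omega>)" 
  shows "{\<omega> \<in> space M. \<exists>s\<in>{0..t}. \<epsilon> < \<bar>simple_value S s \<omega> - H s \<omega>\<bar>} \<in> sets M"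
proof (rule sets_ex_gt_left_continuous)
  show "AE \<omega> in M. \<forall>s. 0 < s \<longrightarrow> s \<le> t \<longrightarrow> continuous (at_left s) (\<lambda>s. simple_value S s \<omega> - H s \<omega>)"
    using H(2)
  proof eventually_elim
    fix \<omega> assume "caglad (\<lambda>t. H t \<omega>)"
    then show "\<forall>s. 0 < s \<longrightarrow> s \<le> t \<longrightarrow> continuous (at_left s) (\<lambda>s. simple_value S s \<omega> - H s \<omega>)"
      using simple_value_tendsto_left[of _ S \<omega>]
      by (auto simp: caglad_def continuous_within intro!: tendsto_diff)
  qed
  show "(\<lambda>\<omega>. simple_value S s \<omega> - H s \<omega>) \<in> borel_measurable M" if "0 \<le> s" for s
    using simple_value_measurable[OF S that] adapted_imp_measurable[OF H(1) that] by simp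
qed auto

text \<open>At horizon 0 every elementary integral vanishes, so the error probabilities in
  \<open>ucp_tendsto\<close> do not depend on \<open>k\<close>; tending to 0, they are 0.\<close>

lemma X_initial: "AE \<omega> in M. X 0 \<omega> = x"
proof -
  obtain Z S where S: "\<And>k. simple_predictable M F (S k)"
    and SL: "ucp_tendsto M (\<lambda>k. simple_integral (S k) L) Z"
    and Z: "adapted F Z" "AE \<omega> in M. \<forall>t\<ge>0. X t \<omega> = x + Z t \<omega>"
    using ex_simple_approximation by blast
  have [measurable]: "Z 0 \<in> borel_measurable M" by (rule adapted_imp_measurable[OF Z(1)]) simp
  have zero: "simple_integral (S k) L 0 \<omega> = 0" if "\<omega> \<in> space M" for k \<omega>
    using simple_predictable_time_nonneg[OF S that] by (auto simp: simple_integral_def min_def)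
  have "AE \<omega> in M. \<not> inverse (real (Suc m)) < \<bar>Z 0 \<omega>\<bar>" for m
  proof -
    let ?\<epsilon> = "inverse (real (Suc m))"
    have "(\<lambda>k. prob {\<omega> \<in> space M. \<exists>s\<in>{0..0}. ?\<epsilon> < \<bar>simple_integral (S k) L s \<omega> - Z s \<omega>\<bar>}) \<longlonglongrightarrow> 0"
      using SL by (auto simp: ucp_tendsto_def)
    also have "(\<lambda>k. prob {\<omega> \<in> space M. \<exists>s\<in>{0..0}. ?\<epsilon> < \<bar>simple_integral (S k) L s \<omega> - Z s \<omega>\<bar>})
        = (\<lambda>k. prob {\<omega> \<in> space M. ?\<epsilon> < \<bar>Z 0 \<omega>\<bar>})"
      by (intro ext arg_cong[where f = prob]) (auto simp: zero)
    finally have "prob {\<omega> \<in> space M. ?\<epsilon> < \<bar>Z 0 \<omega>\<bar>} = 0" by (simp add: LIMSEQ_const_iff)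
    then show ?thesis by (subst (asm) prob_eq_0) auto
  qed
  then have "AE \<omega> in M. \<forall>m. \<not> inverse (real (Suc m)) < \<bar>Z 0 \<omega>\<bar>" by (subst AE_all_countable) blast
  with Z(2) show ?thesis
  proof eventually_elim
    fix \<omega> assume "\<forall>t\<ge>0. X t \<omega> = x + Z t \<omega>" "\<forall>m. \<not> inverse (real (Suc m)) < \<bar>Z 0 \<omega>\<bar>"
    then show "X 0 \<omega> = x" using reals_Archimedean[of "\<bar>Z 0 \<omega>\<bar>"] by fastforce
  qed
qed

text \<open>Four errors are controlled: simple process against integrand, its integral against
  \<open>Z\<close>, its Riemann sum against its integral, and its Riemann sum against that of
  \<open>\<sigma> (X s)\<close>. The first two fix \<open>k\<close>, the third then fixes
  \<open>n\<close>, and the last is a Riemann sum with coefficients of size at most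
  \<open>\<epsilon>\<close>, estimated for every \<open>n\<close>. Each costs \<open>t / 4\<close>,
  and the large increments in the last one cost \<open>K * t\<close>.\<close>

lemma ex_riemann_approximation:
  assumes t: "0 < t" "t \<le> 1" and \<eta>: "0 < \<eta>"
  obtains n where "0 < n"
    and "prob {\<omega> \<in> space M. \<eta> < \<bar>X t \<omega> - x - riemann_sum (\<lambda>s \<omega>. \<sigma> (X s \<omega>)) L (t / real n) n \<omega>\<bar>} \<le> (K + 1) * t"
proof -
  define C where "C = 2 * K * exp K"
  have C: "0 \<le> C" using K_nonneg by (simp add: C_def)
  \<comment> \<open>Chosen to make the Chebyshev term of the fourth error equal to
    \<open>C / (C + 1) * (t / 4)\<close>; the 1 avoids a division by 0 when
    \<open>K = 0\<close>.\<close>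
  define \<epsilon> where "\<epsilon> = \<eta> / (6 * sqrt (C + 1))"
  have \<epsilon>: "0 < \<epsilon>" using \<eta> C by (auto simp: \<epsilon>_def intro!: divide_pos_pos mult_pos_pos real_sqrt_gt_zero)
  have \<epsilon>2: "\<epsilon>\<^sup>2 = \<eta>\<^sup>2 / (36 * (C + 1))" using C by (simp add: \<epsilon>_def power_divide power_mult_distrib)
  have C\<epsilon>: "C * t * \<epsilon>\<^sup>2 / (\<eta> / 3)\<^sup>2 \<le> t / 4"
  proof -
    have "C * t * \<epsilon>\<^sup>2 / (\<eta> / 3)\<^sup>2 = (C / (C + 1)) * (t / 4)"
    proof -
      have "C + 1 \<noteq> 0" using C by simp
      then have "\<epsilon>\<^sup>2 / (\<eta> / 3)\<^sup>2 = 1 / (4 * (C + 1))"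
        using \<eta> unfolding \<epsilon>2 by (simp add: power_divide divide_simps)
      then have "C * t * (\<epsilon>\<^sup>2 / (\<eta> / 3)\<^sup>2) = C * t * (1 / (4 * (C + 1)))" by simp
      then show ?thesis by simp
    qed
    also have "\<dots> \<le> 1 * (t / 4)" using C t by (intro mult_right_mono) auto
    finally show ?thesis by simp
  qed
  let ?H = "\<lambda>t \<omega>. \<sigma> (left_limit X t \<omega>)"
  obtain Z S where S: "\<And>k. simple_predictable M F (S k)"
    and SH: "ucp_tendsto M (\<lambda>k. simple_value (S k)) ?H"
    and SL: "ucp_tendsto M (\<lambda>k. simple_integral (S k) L) Z"
    and H: "adapted F ?H" "AE \<omega> in M. caglad (\<lambda>t. ?H t \<omega>)"
    and Z: "adapted F Z" "AE \<omega> in M. cadlag (\<lambda>t. Z t \<omega>)"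
    and XZ: "AE \<omega> in M. \<forall>t\<ge>0. X t \<omega> = x + Z t \<omega>"
    using ex_simple_approximation by blast
  let ?A1 = "\<lambda>k. {\<omega> \<in> space M. \<exists>s\<in>{0..t}. \<epsilon> < \<bar>simple_value (S k) s \<omega> - ?H s \<omega>\<bar>}"
  let ?A2 = "\<lambda>k. {\<omega> \<in> space M. \<exists>s\<in>{0..t}. \<eta> / 3 < \<bar>simple_integral (S k) L s \<omega> - Z s \<omega>\<bar>}"
  have "(\<lambda>k. prob (?A1 k)) \<longlonglongrightarrow> 0" "(\<lambda>k. prob (?A2 k)) \<longlonglongrightarrow> 0"
    using SH[unfolded ucp_tendsto_def, rule_format, of t \<epsilon>] SL[unfolded ucp_tendsto_def, rule_format, of t "\<eta> / 3"]
      t \<epsilon> \<eta> by simp_all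
  then have "eventually (\<lambda>k. prob (?A1 k) < t / 4 \<and> prob (?A2 k) < t / 4) sequentially"
    using t by (intro eventually_conj order_tendstoD(2)[where y = 0]) auto
  then obtain k where k: "prob (?A1 k) < t / 4" "prob (?A2 k) < t / 4"
    by (auto simp: eventually_sequentially)
  let ?D0 = "simple_right_limit (S k)"
  let ?A3 = "\<lambda>n. {\<omega> \<in> space M. \<eta> / 3 < \<bar>riemann_sum ?D0 L (t / real n) n \<omega> - simple_integral (S k) L t \<omega>\<bar>}"
  have "(\<lambda>n. prob (?A3 n)) \<longlonglongrightarrow> 0"
    by (rule riemann_sum_simple_prob_tendsto[OF S t(1)]) (use \<eta> in simp)
  then have "eventually (\<lambda>n. prob (?A3 n) < t / 4 \<and> 0 < n) sequentially"
    using t by (intro eventually_conj order_tendstoD(2)[where y = 0] eventually_gt_at_top) auto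
  then obtain n where n: "prob (?A3 n) < t / 4" "0 < n"
    by (auto simp: eventually_sequentially)
  define h where "h = t / real n"
  have h: "0 < h" "h * real n = t" using t n by (auto simp: h_def)
  \<comment> \<open>Strict, because the value at a grid time is obtained as a right limit over times
    at which the uniform bound on \<open>[0, t]\<close> is still valid.\<close>
  have hj: "h * real j < t" if "j < n" for j
    using h that by (metis mult_less_cancel_left_pos of_nat_less_iff)
  \<comment> \<open>Clipping changes nothing where the approximation is within \<open>\<epsilon>\<close>, and it makes the moment bound available.\<close>
  define D where "D s \<omega> = max (- \<epsilon>) (min \<epsilon> (?D0 s \<omega> - \<sigma> (X s \<omega>)))" for s \<omega>
  have D: "adapted F D"
    using simple_right_limit_adapted[OF S] \<sigma>_X_adapted unfolding adapted_def D_def[abs_def]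
    by (auto intro!: borel_measurable_max borel_measurable_min borel_measurable_diff)
  have D_bound: "\<bar>D s \<omega>\<bar> \<le> \<epsilon>" for s \<omega> using \<epsilon> by (auto simp: D_def)
  have D2: "expectation (\<lambda>\<omega>. (D (h * real j) \<omega>)\<^sup>2) \<le> \<epsilon>\<^sup>2" for j
  proof -
    have [measurable]: "D (h * real j) \<in> borel_measurable M" using h by (intro adapted_imp_measurable[OF D]) auto
    have sq: "(D (h * real j) \<omega>)\<^sup>2 \<le> \<epsilon>\<^sup>2" for \<omega>
      using power_mono[OF D_bound[of "h * real j" \<omega>], of 2] by simp
    have "expectation (\<lambda>\<omega>. (D (h * real j) \<omega>)\<^sup>2) \<le> expectation (\<lambda>\<omega>. \<epsilon>\<^sup>2)"
      by (intro integral_mono integrable_bounded[where B = "\<epsilon>\<^sup>2"]) (use sq in auto)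
    then show ?thesis by (simp add: prob_space)
  qed
  let ?A4 = "{\<omega> \<in> space M. \<eta> / 3 < \<bar>riemann_sum D L h n \<omega>\<bar>}"
  have "prob ?A4 \<le> K * (h * real n) + 2 * K * exp K * (h * real n) * \<epsilon>\<^sup>2 / (\<eta> / 3)\<^sup>2"
    by (rule prob_riemann_sum_gt[OF D D_bound _ _ D2]) (use h t \<eta> in auto)
  then have A4: "prob ?A4 \<le> K * t + t / 4" using C\<epsilon> h by (simp add: C_def)
  have A12: "?A1 k \<in> sets M" "?A2 k \<in> sets M"
    by (rule simple_value_error_sets[OF S H] simple_integral_error_sets[OF S Z])+
  have [measurable]: "riemann_sum ?D0 L h n \<in> borel_measurable M" "riemann_sum D L h n \<in> borel_measurable M"
    "simple_integral (S k) L t \<in> borel_measurable M"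
    using h t D simple_right_limit_adapted[OF S] simple_integral_measurable[OF S]
    by (auto intro!: riemann_sum_measurable)
  have A3': "?A3 n \<in> sets M" "?A4 \<in> sets M" unfolding h_def[symmetric] by measurable
  let ?A = "{\<omega> \<in> space M. \<eta> < \<bar>X t \<omega> - x - riemann_sum (\<lambda>s \<omega>. \<sigma> (X s \<omega>)) L h n \<omega>\<bar>}"
  have "AE \<omega> in M. \<omega> \<in> ?A \<longrightarrow> \<omega> \<in> ?A1 k \<union> ?A2 k \<union> ?A3 n \<union> ?A4"
    using X_cadlag XZ
  proof eventually_elim
    fix \<omega> assume cad: "cadlag (\<lambda>t. X t \<omega>)" and eq: "\<forall>t\<ge>0. X t \<omega> = x + Z t \<omega>"
    show "\<omega> \<in> ?A \<longrightarrow> \<omega> \<in> ?A1 k \<union> ?A2 k \<union> ?A3 n \<union> ?A4"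
    proof (intro impI, rule ccontr)
      assume A: "\<omega> \<in> ?A" and no: "\<omega> \<notin> ?A1 k \<union> ?A2 k \<union> ?A3 n \<union> ?A4"
      have 1: "\<bar>simple_value (S k) s \<omega> - ?H s \<omega>\<bar> \<le> \<epsilon>" if "0 \<le> s" "s \<le> t" for s
        using no A that by (auto simp: not_less)
      have D0_le: "\<bar>?D0 s \<omega> - \<sigma> (X s \<omega>)\<bar> \<le> \<epsilon>" if s: "0 \<le> s" "s < t" for s
      proof -
        \<comment> \<open>The uniform bound compares left-continuous processes; taking right limits
          at \<open>s\<close> turns it into a bound between the adapted values used in the Riemann
          sums.\<close>
        have "((\<lambda>r. \<bar>simple_value (S k) r \<omega> - ?H r \<omega>\<bar>) \<longlongrightarrow> \<bar>?D0 s \<omega> - \<sigma> (X s \<omega>)\<bar>) (at_right s)"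
          by (intro tendsto_rabs tendsto_diff simple_value_tendsto_right
              cadlag_left_limit_tendsto_right[where X = X, OF cad \<sigma>_continuous] s)
        moreover have "eventually (\<lambda>r. \<bar>simple_value (S k) r \<omega> - ?H r \<omega>\<bar> \<le> \<epsilon>) (at_right s)"
          by (rule eventually_at_rightI[of s t]) (use 1 s in auto)
        ultimately show ?thesis by (rule tendsto_upperbound) simp
      qed
      have "D s \<omega> = ?D0 s \<omega> - \<sigma> (X s \<omega>)" if "0 \<le> s" "s < t" for s
      proof -
        have "?D0 s \<omega> - \<sigma> (X s \<omega>) \<le> \<epsilon>" "- \<epsilon> \<le> ?D0 s \<omega> - \<sigma> (X s \<omega>)" using D0_le[OF that] by linarith+
        then show ?thesis by (simp only: D_def min_absorb2 max_absorb2)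
      qed
      then have "riemann_sum D L h n \<omega> = riemann_sum (\<lambda>s \<omega>. ?D0 s \<omega> - \<sigma> (X s \<omega>)) L h n \<omega>"
        using h hj by (intro riemann_sum_cong) auto
      then have R: "riemann_sum D L h n \<omega> = riemann_sum ?D0 L h n \<omega> - riemann_sum (\<lambda>s \<omega>. \<sigma> (X s \<omega>)) L h n \<omega>"
        by (simp only: riemann_sum_diff)
      have 2: "\<bar>simple_integral (S k) L t \<omega> - Z t \<omega>\<bar> \<le> \<eta> / 3" using no A t by (auto simp: not_less)
      have 3: "\<bar>riemann_sum ?D0 L h n \<omega> - simple_integral (S k) L t \<omega>\<bar> \<le> \<eta> / 3"
        using no A by (auto simp: not_less h_def)
      have 4: "\<bar>riemann_sum D L h n \<omega>\<bar> \<le> \<eta> / 3" using no A by (auto simp: not_less)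
      have "X t \<omega> = x + Z t \<omega>" using eq t by simp
      then have "\<bar>X t \<omega> - x - riemann_sum (\<lambda>s \<omega>. \<sigma> (X s \<omega>)) L h n \<omega>\<bar> \<le> \<eta>"
        using 2 3 4 R by linarith
      then show False using A by simp
    qed
  qed
  then have "prob ?A \<le> prob (?A1 k \<union> ?A2 k \<union> ?A3 n \<union> ?A4)"
    by (rule finite_measure_mono_AE) (intro sets.Un A12 A3')
  also have "\<dots> \<le> prob (?A1 k \<union> ?A2 k \<union> ?A3 n) + prob ?A4"
    by (intro measure_Un_le sets.Un A12 A3')
  also have "prob (?A1 k \<union> ?A2 k \<union> ?A3 n) \<le> prob (?A1 k \<union> ?A2 k) + prob (?A3 n)"
    by (intro measure_Un_le sets.Un A12 A3')
  also have "prob (?A1 k \<union> ?A2 k) \<le> prob (?A1 k) + prob (?A2 k)"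
    by (intro measure_Un_le A12)
  finally have "prob ?A \<le> (K + 1) * t" using k n(1) A4 by (simp add: algebra_simps)
  then show thesis using n(2) by (intro that[of n]) (auto simp: h_def)
qed

text \<open>An event in place of an exit time: the indicator of its complement can multiply the
  coefficients and stays adapted. Time \<open>t\<close> is included, so off the event
  \<open>X t\<close> itself is within 1 of \<open>x\<close> and no overshoot has to be
  estimated.\<close>

definition escape :: "real \<Rightarrow> 'a set" where
  "escape t = {\<omega> \<in> space M. \<exists>s\<in>{0..t}. 1 < \<bar>X s \<omega> - x\<bar>}"

lemma escape_sets_F: "0 \<le> t \<Longrightarrow> escape t \<in> sets (F t)"
  unfolding escape_def
proof (rule sets_ex_gt_right_continuous)
  assume t: "0 \<le> t"
  show "null_sets M \<subseteq> sets (F t)" using null_sets_F sets_F_mono[OF t] by blast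
  show "AE \<omega> in M. \<forall>s. 0 \<le> s \<longrightarrow> s < t \<longrightarrow> continuous (at_right s) (\<lambda>s. X s \<omega> - x)"
    using X_right_continuous by eventually_elim (auto intro!: continuous_diff continuous_const)
  show "(\<lambda>\<omega>. X s \<omega> - x) \<in> borel_measurable (F t)" if "0 \<le> s" "s \<le> t" for s
    using borel_measurable_F_mono[of "X s" s t] X_adapted that by (auto simp: adapted_def)
qed (simp add: space_F)

lemma escape_sets [measurable]: "0 \<le> t \<Longrightarrow> escape t \<in> sets M"
  using escape_sets_F sets_F_le by blast

lemma escape_mono: "s \<le> t \<Longrightarrow> escape s \<subseteq> escape t"
  by (auto simp: escape_def)

lemma not_escapeD: "\<omega> \<in> space M \<Longrightarrow> \<omega> \<notin> escape t \<Longrightarrow> 0 \<le> s \<Longrightarrow> s \<le> t \<Longrightarrow> \<bar>X s \<omega> - x\<bar> \<le> 1"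
  by (auto simp: escape_def not_less)

text \<open>A qualitative statement: by right continuity at 0 and \<open>X 0 = x\<close>, almost no
  path escapes before every positive time, and continuity of the measure from above
  concludes.\<close>

lemma prob_escape_tendsto: "((\<lambda>t. prob (escape t)) \<longlongrightarrow> 0) (at_right 0)"
proof -
  let ?A = "\<lambda>n. escape (inverse (real (Suc n)))"
  have dec: "decseq ?A"
    by (intro decseq_SucI escape_mono) (auto intro: le_imp_inverse_le)
  have "(\<lambda>n. prob (?A n)) \<longlonglongrightarrow> prob (\<Inter>n. ?A n)"
    by (rule finite_Lim_measure_decseq[OF _ dec]) auto
  moreover have "prob (\<Inter>n. ?A n) = 0"
  proof -
    have "AE \<omega> in M. \<omega> \<notin> (\<Inter>n. ?A n)"
      using X_right_continuous X_initial
    proof eventually_elim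
      fix \<omega> assume "\<forall>s\<ge>0. continuous (at_right s) (\<lambda>s. X s \<omega>)" and X0: "X 0 \<omega> = x"
      then have "((\<lambda>s. X s \<omega>) \<longlongrightarrow> x) (at_right 0)" by (auto simp: continuous_within dest: spec[of _ 0])
      then have "eventually (\<lambda>s. dist (X s \<omega>) x < 1) (at_right 0)" by (rule tendstoD) simp
      then obtain b where b: "b > 0" "\<And>s. 0 < s \<Longrightarrow> s < b \<Longrightarrow> dist (X s \<omega>) x < 1"
        unfolding eventually_at_right_field by auto
      obtain n where n: "inverse (real (Suc n)) < b" using reals_Archimedean[OF b(1)] by blast
      have "\<bar>X s \<omega> - x\<bar> \<le> 1" if "s \<in> {0..inverse (real (Suc n))}" for s
        using b(2)[of s] X0 that n by (cases "s = 0") (auto simp: dist_real_def)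
      then have "\<omega> \<notin> ?A n" by (force simp: escape_def)
      then show "\<omega> \<notin> (\<Inter>n. ?A n)" by blast
    qed
    then show ?thesis by (subst prob_eq_0) auto
  qed
  ultimately have lim: "(\<lambda>n. prob (?A n)) \<longlonglongrightarrow> 0" by simp
  show ?thesis
  proof (rule tendstoI)
    fix e :: real assume "0 < e"
    then obtain n where n: "prob (?A n) < e"
      using order_tendstoD(2)[OF lim] by (auto simp: eventually_sequentially)
    have "dist (prob (escape t)) 0 < e" if "0 < t" "t < inverse (real (Suc n))" for t
    proof -
      have "prob (escape t) \<le> prob (?A n)"
        using that by (intro finite_measure_mono escape_mono) auto
      then show ?thesis using n by simp
    qed
    then show "eventually (\<lambda>t. dist (prob (escape t)) 0 < e) (at_right 0)"
      unfolding eventually_at_right_field by (intro exI[of _ "inverse (real (Suc n))"]) auto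
  qed
qed

lemma stopped_adapted:
  fixes g :: "real \<Rightarrow> real"
  assumes g: "continuous_on UNIV g"
  shows "adapted F (\<lambda>s \<omega>. g (X s \<omega>) * indicator (space M - escape s) \<omega>)"
  unfolding adapted_def
proof (intro allI impI)
  fix s :: real assume s: "0 \<le> s"
  have [measurable]: "X s \<in> borel_measurable (F s)" using X_adapted s by (simp add: adapted_def)
  have [measurable]: "g \<in> borel_measurable borel" by (rule borel_measurable_continuous_onI[OF g])
  have [measurable]: "space M - escape s \<in> sets (F s)"
    using escape_sets_F[OF s] sets.top[of "F s"] by (auto simp: space_F)
  show "(\<lambda>\<omega>. g (X s \<omega>) * indicator (space M - escape s) \<omega>) \<in> borel_measurable (F s)" by measurable
qed

lemma \<sigma>_bound: "\<bar>y - x\<bar> \<le> 1 \<Longrightarrow> \<bar>\<sigma> y\<bar> \<le> \<bar>\<sigma> x\<bar> + \<kappa>"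
  using \<sigma>_lipschitz[of y] mult_left_mono[of "\<bar>y - x\<bar>" 1 \<kappa>] \<kappa>_nonneg by simp

text \<open>The first term is twice the truncated second-moment bound with coefficients at most
  \<open>\<bar>\<sigma> x\<bar> + \<kappa>\<close>, the 2 coming from squaring a sum of two terms.
  The rest adds the rate \<open>K + 1\<close> of a failed Riemann approximation to the rate
  \<open>K\<close> of a large increment.\<close>

definition displacement_rate :: real where
  "displacement_rate = 4 * K * exp K * (\<bar>\<sigma> x\<bar> + \<kappa>)\<^sup>2 + 2 * K + 1"

lemma displacement_rate_nonneg: "0 \<le> displacement_rate"
  using K_nonneg by (simp add: displacement_rate_def)

text \<open>Before escape the squared displacement is at most 1, so an exceptional event of
  probability O(s) contributes only O(s). Off that event \<open>X s - x\<close> is within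
  \<open>\<eta>\<close> of a truncated Riemann sum, whose second moment is O(s) as well.\<close>

lemma displacement_second_moment:
  assumes s: "0 \<le> s" "s \<le> 1"
  shows "expectation (\<lambda>\<omega>. (X s \<omega> - x)\<^sup>2 * indicator (space M - escape s) \<omega>) \<le> displacement_rate * s"
proof (cases "s = 0")
  case True
  have "expectation (\<lambda>\<omega>. (X 0 \<omega> - x)\<^sup>2 * indicator (space M - escape 0) \<omega>) = expectation (\<lambda>_. 0)"
    by (rule integral_cong_AE) (use X_initial in auto)
  then show ?thesis using True by simp
next
  case False
  then have s0: "0 < s" using s by simp
  define B where "B = \<bar>\<sigma> x\<bar> + \<kappa>"
  have B: "0 \<le> B" using \<kappa>_nonneg by (simp add: B_def)
  have [measurable]: "X s \<in> borel_measurable M" "escape s \<in> sets M" using s by auto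
  let ?u = "\<lambda>\<omega>. (X s \<omega> - x)\<^sup>2 * indicator (space M - escape s) \<omega>"
  have u_le: "\<bar>?u \<omega>\<bar> \<le> 1" if "\<omega> \<in> space M" for \<omega>
    using not_escapeD[OF that, of s s] s by (auto simp: indicator_def abs_square_le_1)
  show ?thesis
  proof (rule field_le_epsilon)
    fix e :: real assume "0 < e"
    \<comment> \<open>The approximation error then contributes exactly the arbitrary
      \<open>e\<close>. The grid depends on \<open>e\<close>, the bounds do not.\<close>
    define \<eta> where "\<eta> = sqrt (e / 2)"
    have \<eta>: "0 < \<eta>" "2 * \<eta>\<^sup>2 = e" using \<open>0 < e\<close> by (auto simp: \<eta>_def)
    obtain n where n: "0 < n" and close:
      "prob {\<omega> \<in> space M. \<eta> < \<bar>X s \<omega> - x - riemann_sum (\<lambda>s \<omega>. \<sigma> (X s \<omega>)) L (s / real n) n \<omega>\<bar>} \<le> (K + 1) * s"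
      using ex_riemann_approximation[OF s0 s(2) \<eta>(1)] by blast
    define h where "h = s / real n"
    have h: "0 \<le> h" "h * real n = s" using n s0 by (auto simp: h_def)
    have hj: "h * real j \<le> s" if "j < n" for j
      using h that by (metis less_imp_le mult_left_mono of_nat_mono)
    let ?D = "\<lambda>s \<omega>. \<sigma> (X s \<omega>) * indicator (space M - escape s) \<omega>"
    let ?N = "truncated_riemann_sum ?D L h n"
    have D: "adapted F ?D" by (rule stopped_adapted[OF \<sigma>_continuous])
    have D_bound: "\<bar>?D r \<omega>\<bar> \<le> B" if "0 \<le> r" "\<omega> \<in> space M" for r \<omega>
      using \<sigma>_bound[OF not_escapeD[OF that(2), of r r]] that B by (auto simp: indicator_def B_def)
    have D2: "expectation (\<lambda>\<omega>. (?D (h * real j) \<omega>)\<^sup>2) \<le> B\<^sup>2" for j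
    proof -
      have [measurable]: "?D (h * real j) \<in> borel_measurable M" using h by (intro adapted_imp_measurable[OF D]) auto
      have sq: "(?D (h * real j) \<omega>)\<^sup>2 \<le> B\<^sup>2" if "\<omega> \<in> space M" for \<omega>
        using power_mono[OF D_bound[of "h * real j" \<omega>], of 2] that h by simp
      have "expectation (\<lambda>\<omega>. (?D (h * real j) \<omega>)\<^sup>2) \<le> expectation (\<lambda>\<omega>. B\<^sup>2)"
        by (intro integral_mono integrable_bounded[where B = "B\<^sup>2"]) (use sq in auto)
      then show ?thesis by (simp add: prob_space)
    qed
    have N2: "expectation (\<lambda>\<omega>. (?N \<omega>)\<^sup>2) \<le> 2 * K * exp K * (h * real n) * B\<^sup>2"
      by (rule truncated_riemann_sum_second_moment_le[OF D D_bound h(1) _ D2]) (use h s in auto)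
    have [measurable]: "?N \<in> borel_measurable M"
      by (rule borel_measurable_F_imp_M[OF truncated_riemann_sum_measurable[OF D h(1) order_refl]]) (use h in auto)
    have [measurable]: "riemann_sum (\<lambda>s \<omega>. \<sigma> (X s \<omega>)) L h n \<in> borel_measurable M"
      by (rule riemann_sum_measurable[OF \<sigma>_X_adapted h(1)])
    have [measurable]: "L (h * real j) \<in> borel_measurable M" for j using h by auto
    let ?A = "{\<omega> \<in> space M. \<eta> < \<bar>X s \<omega> - x - riemann_sum (\<lambda>s \<omega>. \<sigma> (X s \<omega>)) L h n \<omega>\<bar>}"
    let ?J = "{\<omega> \<in> space M. \<exists>j<n. 1 < \<bar>L (h * real (Suc j)) \<omega> - L (h * real j) \<omega>\<bar>}"
    have AJ [measurable]: "?A \<in> sets M" "?J \<in> sets M" by measurable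
    have N_int: "integrable M (\<lambda>\<omega>. (?N \<omega>)\<^sup>2)"
    proof (rule integrable_bounded)
      show "\<bar>(?N \<omega>)\<^sup>2\<bar> \<le> (real n * B)\<^sup>2" if "\<omega> \<in> space M" for \<omega>
        using power_mono[OF truncated_riemann_sum_bound[OF D_bound h(1) that], where n = 2] by simp
    qed measurable
    have ind_int: "integrable M (indicator (?A \<union> ?J) :: 'a \<Rightarrow> real)"
      by (rule integrable_bounded[OF borel_measurable_indicator[OF sets.Un[OF AJ]] indicator_abs_le_1])
    have le: "?u \<omega> \<le> 2 * (?N \<omega>)\<^sup>2 + 2 * \<eta>\<^sup>2 + indicator (?A \<union> ?J) \<omega>" if \<omega>: "\<omega> \<in> space M" for \<omega>
    proof (cases "\<omega> \<in> escape s \<or> \<omega> \<in> ?A \<union> ?J")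
      case True
      have "?u \<omega> \<le> indicator (?A \<union> ?J) \<omega>"
      proof (cases "\<omega> \<in> ?A \<union> ?J")
        case True
        then have "(indicator (?A \<union> ?J) \<omega> :: real) = 1" by (rule indicator_simps)
        then show ?thesis using u_le[OF \<omega>] by linarith
      next
        case False
        then have "\<omega> \<in> escape s" using True by blast
        then show ?thesis by simp
      qed
      moreover have "0 \<le> (?N \<omega>)\<^sup>2" "0 \<le> \<eta>\<^sup>2" by simp_all
      ultimately show ?thesis by linarith
    next
      case False
      then have ne: "\<omega> \<notin> escape s" by blast
      \<comment> \<open>A path that has not escaped by \<open>s\<close> has not escaped at any
        earlier grid time, so every switch-off factor is 1.\<close>
      have "\<omega> \<notin> escape (h * real j)" if "j < n" for j using ne escape_mono[OF hj[OF that]] by blast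
      then have "riemann_sum (\<lambda>s \<omega>. \<sigma> (X s \<omega>)) L h n \<omega> = riemann_sum ?D L h n \<omega>"
        using \<omega> by (intro riemann_sum_cong) simp
      also have "\<dots> = ?N \<omega>"
      proof (rule riemann_sum_eq_truncated)
        have "\<omega> \<notin> ?J" using False by blast
        then show "\<not> (\<exists>j<n. 1 < \<bar>L (h * real (Suc j)) \<omega> - L (h * real j) \<omega>\<bar>)" using \<omega> by blast
      qed
      finally have eq: "riemann_sum (\<lambda>s \<omega>. \<sigma> (X s \<omega>)) L h n \<omega> = ?N \<omega>" .
      have "\<omega> \<notin> ?A" using False by blast
      then have "\<bar>X s \<omega> - x - ?N \<omega>\<bar> \<le> \<eta>" unfolding eq[symmetric] using \<omega> by simp
      then have "(X s \<omega> - x - ?N \<omega>)\<^sup>2 \<le> \<eta>\<^sup>2" using power_mono[of "\<bar>X s \<omega> - x - ?N \<omega>\<bar>" \<eta> 2] by simp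
      moreover have "(X s \<omega> - x)\<^sup>2 \<le> 2 * (?N \<omega>)\<^sup>2 + 2 * (X s \<omega> - x - ?N \<omega>)\<^sup>2"
        using sum_squares_bound[of "?N \<omega>" "X s \<omega> - x - ?N \<omega>"]
          power2_sum[of "?N \<omega>" "X s \<omega> - x - ?N \<omega>"] by simp
      ultimately have "(X s \<omega> - x)\<^sup>2 \<le> 2 * (?N \<omega>)\<^sup>2 + 2 * \<eta>\<^sup>2" by linarith
      moreover have "?u \<omega> = (X s \<omega> - x)\<^sup>2" using ne \<omega> by simp
      moreover have "(0::real) \<le> indicator (?A \<union> ?J) \<omega>" by (rule indicator_pos_le)
      ultimately show ?thesis by linarith
    qed
    have "expectation ?u \<le> expectation (\<lambda>\<omega>. 2 * (?N \<omega>)\<^sup>2 + 2 * \<eta>\<^sup>2 + indicator (?A \<union> ?J) \<omega>)"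
    proof (intro integral_mono le)
      show "integrable M ?u" by (rule integrable_bounded[OF _ u_le]) measurable
      show "integrable M (\<lambda>\<omega>. 2 * (?N \<omega>)\<^sup>2 + 2 * \<eta>\<^sup>2 + indicator (?A \<union> ?J) \<omega>)"
        by (intro Bochner_Integration.integrable_add integrable_mult_right N_int integrable_const ind_int)
    qed
    also have "\<dots> = 2 * expectation (\<lambda>\<omega>. (?N \<omega>)\<^sup>2) + 2 * \<eta>\<^sup>2 + prob (?A \<union> ?J)"
    proof -
      have "expectation (\<lambda>\<omega>. 2 * (?N \<omega>)\<^sup>2 + 2 * \<eta>\<^sup>2 + indicator (?A \<union> ?J) \<omega>)
          = expectation (\<lambda>\<omega>. 2 * (?N \<omega>)\<^sup>2 + 2 * \<eta>\<^sup>2) + expectation (indicator (?A \<union> ?J))"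
        by (intro Bochner_Integration.integral_add Bochner_Integration.integrable_add integrable_mult_right N_int ind_int
            integrable_const)
      also have "expectation (indicator (?A \<union> ?J)) = prob ((?A \<union> ?J) \<inter> space M)"
        by (rule Bochner_Integration.integral_indicator)
      also have "(?A \<union> ?J) \<inter> space M = ?A \<union> ?J" by (rule sets.Int_space_eq2[OF sets.Un[OF AJ]])
      also have "expectation (\<lambda>\<omega>. 2 * (?N \<omega>)\<^sup>2 + 2 * \<eta>\<^sup>2) = expectation (\<lambda>\<omega>. 2 * (?N \<omega>)\<^sup>2) + expectation (\<lambda>_. 2 * \<eta>\<^sup>2)"
        by (intro Bochner_Integration.integral_add integrable_mult_right N_int integrable_const)
      also have "expectation (\<lambda>_. 2 * \<eta>\<^sup>2) = 2 * \<eta>\<^sup>2" by (simp add: prob_space)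
      also have "expectation (\<lambda>\<omega>. 2 * (?N \<omega>)\<^sup>2) = 2 * expectation (\<lambda>\<omega>. (?N \<omega>)\<^sup>2)" by (rule integral_mult_right_zero)
      finally show ?thesis .
    qed
    also have "prob (?A \<union> ?J) \<le> (K + 1) * s + K * s"
    proof -
      have "prob (?A \<union> ?J) \<le> prob ?A + prob ?J" by (intro measure_Un_le AJ)
      moreover have "prob ?J \<le> K * s" using prob_large_increment_grid[OF h(1), of n] h by simp
      ultimately show ?thesis using close by (simp add: h_def)
    qed
    finally have "expectation ?u \<le> 2 * (2 * K * exp K * s * B\<^sup>2) + e + ((K + 1) * s + K * s)"
      using N2 \<eta>(2) unfolding h(2) by linarith
    also have "\<dots> = displacement_rate * s + e"
    proof -
      have "displacement_rate = 4 * K * exp K * B\<^sup>2 + 2 * K + 1" by (simp add: displacement_rate_def B_def)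
      then show ?thesis by (simp add: algebra_simps)
    qed
    finally show "expectation ?u \<le> displacement_rate * s + e" .
  qed
qed

text \<open>The coefficients \<open>\<sigma> (X s) - \<sigma> x\<close> inherit a second moment O(t)
  from the displacement through the Lipschitz bound; summing against \<open>L\<close> over time
  \<open>t\<close> gains another factor \<open>t\<close>. Half of \<open>\<theta>\<close> goes to
  the Riemann approximation and half to this sum, which turns the constant 2 of the second-moment
  bound into 8.\<close>

lemma linearization_error:
  assumes t: "0 < t" "t \<le> 1" and \<theta>: "0 < \<theta>"
  shows "prob {\<omega> \<in> space M. \<theta> < \<bar>X t \<omega> - x - \<sigma> x * L t \<omega>\<bar>}
    \<le> prob (escape t) + (2 * K + 1) * t + 8 * K * exp K * \<kappa>\<^sup>2 * displacement_rate * (t / \<theta>)\<^sup>2"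
proof -
  obtain n where n: "0 < n" and close:
    "prob {\<omega> \<in> space M. \<theta> / 2 < \<bar>X t \<omega> - x - riemann_sum (\<lambda>s \<omega>. \<sigma> (X s \<omega>)) L (t / real n) n \<omega>\<bar>} \<le> (K + 1) * t"
    using ex_riemann_approximation[OF t, of "\<theta> / 2"] \<theta> by auto
  define h where "h = t / real n"
  have h: "0 \<le> h" "h * real n = t" using n t by (auto simp: h_def)
  have hj: "h * real j \<le> t" if "j < n" for j
    using h that by (metis less_imp_le mult_left_mono of_nat_mono)
  let ?g = "\<lambda>y. \<sigma> y - \<sigma> x"
  let ?D = "\<lambda>s \<omega>. ?g (X s \<omega>) * indicator (space M - escape s) \<omega>"
  have D: "adapted F ?D" by (rule stopped_adapted) (intro continuous_intros \<sigma>_continuous)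
  have D_le: "\<bar>?D r \<omega>\<bar> \<le> \<kappa> * \<bar>X r \<omega> - x\<bar> * indicator (space M - escape r) \<omega>" if "0 \<le> r" "\<omega> \<in> space M" for r \<omega>
    using \<sigma>_lipschitz[OF not_escapeD[OF that(2), of r r]] that by (auto simp: indicator_def)
  have D_bound: "\<bar>?D r \<omega>\<bar> \<le> \<kappa>" if "0 \<le> r" "\<omega> \<in> space M" for r \<omega>
  proof (cases "\<omega> \<in> escape r")
    case False
    then have "\<kappa> * \<bar>X r \<omega> - x\<bar> \<le> \<kappa> * 1"
      using not_escapeD[OF that(2), of r r] that \<kappa>_nonneg by (intro mult_left_mono) auto
    then show ?thesis using D_le[OF that] False that by (simp add: indicator_def)
  qed (use \<kappa>_nonneg in simp)
  have D2: "expectation (\<lambda>\<omega>. (?D (h * real j) \<omega>)\<^sup>2) \<le> \<kappa>\<^sup>2 * displacement_rate * t" if "j < n" for j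
  proof -
    let ?s = "h * real j"
    have s: "0 \<le> ?s" "?s \<le> t" using h hj[OF that] by auto
    have [measurable]: "X ?s \<in> borel_measurable M" "escape ?s \<in> sets M" using s by auto
    have [measurable]: "?D ?s \<in> borel_measurable M" by (rule adapted_imp_measurable[OF D s(1)])
    let ?u = "\<lambda>\<omega>. (X ?s \<omega> - x)\<^sup>2 * indicator (space M - escape ?s) \<omega>"
    have u_le: "\<bar>?u \<omega>\<bar> \<le> 1" if "\<omega> \<in> space M" for \<omega>
      using not_escapeD[OF that, of ?s ?s] s by (auto simp: indicator_def abs_square_le_1)
    have sq: "(?D ?s \<omega>)\<^sup>2 \<le> \<kappa>\<^sup>2 * ?u \<omega>" if "\<omega> \<in> space M" for \<omega>
      using power_mono[OF D_le[OF s(1) that] abs_ge_zero, of 2] that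
      by (cases "\<omega> \<in> escape ?s") (simp_all add: power_mult_distrib)
    have "expectation (\<lambda>\<omega>. (?D ?s \<omega>)\<^sup>2) \<le> expectation (\<lambda>\<omega>. \<kappa>\<^sup>2 * ?u \<omega>)"
    proof (intro integral_mono sq)
      have "\<bar>(?D ?s \<omega>)\<^sup>2\<bar> \<le> \<kappa>\<^sup>2" if "\<omega> \<in> space M" for \<omega>
        using power_mono[OF D_bound[OF s(1) that] abs_ge_zero, of 2] by simp
      then show "integrable M (\<lambda>\<omega>. (?D ?s \<omega>)\<^sup>2)" by (rule integrable_bounded[rotated]) measurable
      show "integrable M (\<lambda>\<omega>. \<kappa>\<^sup>2 * ?u \<omega>)"
        by (intro integrable_mult_right integrable_bounded[OF _ u_le]) measurable
    qed
    also have "\<dots> = \<kappa>\<^sup>2 * expectation ?u" by (rule integral_mult_right_zero)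
    also have "\<dots> \<le> \<kappa>\<^sup>2 * (displacement_rate * ?s)"
      using s t by (intro mult_left_mono displacement_second_moment) auto
    also have "\<dots> \<le> \<kappa>\<^sup>2 * (displacement_rate * t)"
      using s displacement_rate_nonneg by (intro mult_left_mono) auto
    finally show ?thesis by (simp add: mult.assoc)
  qed
  let ?A = "{\<omega> \<in> space M. \<theta> / 2 < \<bar>X t \<omega> - x - riemann_sum (\<lambda>s \<omega>. \<sigma> (X s \<omega>)) L h n \<omega>\<bar>}"
  let ?E = "{\<omega> \<in> space M. \<theta> / 2 < \<bar>riemann_sum ?D L h n \<omega>\<bar>}"
  have "prob ?E \<le> K * (h * real n) + 2 * K * exp K * (h * real n) * (\<kappa>\<^sup>2 * displacement_rate * t) / (\<theta> / 2)\<^sup>2"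
    by (rule prob_riemann_sum_gt[OF D D_bound h(1) _ D2])
      (use h t \<theta> displacement_rate_nonneg in auto)
  then have E: "prob ?E \<le> K * t + 8 * K * exp K * \<kappa>\<^sup>2 * displacement_rate * (t / \<theta>)\<^sup>2"
    unfolding h by (simp add: power_divide power2_eq_square algebra_simps)
  have [measurable]: "X t \<in> borel_measurable M" "escape t \<in> sets M" using t by auto
  have [measurable]: "riemann_sum (\<lambda>s \<omega>. \<sigma> (X s \<omega>)) L h n \<in> borel_measurable M" "riemann_sum ?D L h n \<in> borel_measurable M"
    by (rule riemann_sum_measurable[OF \<sigma>_X_adapted h(1)] riemann_sum_measurable[OF D h(1)])+
  have AE [measurable]: "?A \<in> sets M" "?E \<in> sets M" by measurable
  let ?G = "{\<omega> \<in> space M. \<theta> < \<bar>X t \<omega> - x - \<sigma> x * L t \<omega>\<bar>}"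
  have "AE \<omega> in M. L 0 \<omega> = 0" using levy by (simp add: levy_process_def)
  then have "AE \<omega> in M. \<omega> \<in> ?G \<longrightarrow> \<omega> \<in> escape t \<union> ?A \<union> ?E"
  proof eventually_elim
    fix \<omega> assume L0: "L 0 \<omega> = 0"
    show "\<omega> \<in> ?G \<longrightarrow> \<omega> \<in> escape t \<union> ?A \<union> ?E"
    proof (intro impI, rule ccontr)
      assume G: "\<omega> \<in> ?G" and no: "\<omega> \<notin> escape t \<union> ?A \<union> ?E"
      have "riemann_sum ?D L h n \<omega> = riemann_sum (\<lambda>s \<omega>. \<sigma> (X s \<omega>) - \<sigma> x) L h n \<omega>"
        using G no escape_mono[OF hj] by (intro riemann_sum_cong) (auto simp: indicator_def)
      \<comment> \<open>With the constant coefficient \<open>\<sigma> x\<close> the Riemann sum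
        telescopes to \<open>\<sigma> x * L t\<close> on every grid, so subtracting it causes no
        further error.\<close>
      also have "\<dots> = riemann_sum (\<lambda>s \<omega>. \<sigma> (X s \<omega>)) L h n \<omega> - \<sigma> x * L t \<omega>"
        by (simp only: riemann_sum_diff riemann_sum_const h L0) simp
      finally have "\<bar>X t \<omega> - x - \<sigma> x * L t \<omega>\<bar>
          \<le> \<bar>X t \<omega> - x - riemann_sum (\<lambda>s \<omega>. \<sigma> (X s \<omega>)) L h n \<omega>\<bar> + \<bar>riemann_sum ?D L h n \<omega>\<bar>" by linarith
      also have "\<dots> \<le> \<theta> / 2 + \<theta> / 2" using no G by (intro add_mono) (auto simp: not_less)
      finally show False using G by simp
    qed
  qed
  then have "prob ?G \<le> prob (escape t \<union> ?A \<union> ?E)"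
    by (intro finite_measure_mono_AE) auto
  also have "\<dots> \<le> prob (escape t \<union> ?A) + prob ?E" by (intro measure_Un_le) auto
  also have "prob (escape t \<union> ?A) \<le> prob (escape t) + prob ?A" by (intro measure_Un_le) auto
  finally show ?thesis using close E by (simp add: h_def algebra_simps)
qed

end

section \<open>Local Lipschitz bound and passage to the limit\<close>

lemma twice_continuously_differentiable_locally_lipschitz:
  assumes "twice_continuously_differentiable \<sigma>"
  obtains \<kappa> where "continuous_on UNIV \<sigma>" "\<And>y. \<bar>y - x\<bar> \<le> 1 \<Longrightarrow> \<bar>\<sigma> y - \<sigma> x\<bar> \<le> \<kappa> * \<bar>y - x\<bar>"
proof -
  obtain \<sigma>' \<sigma>'' where d: "\<And>y. (\<sigma> has_real_derivative \<sigma>' y) (at y)" "\<And>y. (\<sigma>' has_real_derivative \<sigma>'' y) (at y)"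
    using assms by (auto simp: twice_continuously_differentiable_def)
  have "continuous_on {x - 1..x + 1} \<sigma>'"
    using d(2) by (auto intro!: continuous_at_imp_continuous_on DERIV_isCont)
  then have "bounded (\<sigma>' ` {x - 1..x + 1})"
    by (intro compact_imp_bounded compact_continuous_image) auto
  then obtain \<kappa> where "\<forall>v\<in>\<sigma>' ` {x - 1..x + 1}. norm v \<le> \<kappa>" unfolding bounded_iff by blast
  then have \<kappa>: "\<And>y. y \<in> {x - 1..x + 1} \<Longrightarrow> norm (\<sigma>' y) \<le> \<kappa>" by blast
  have "\<bar>\<sigma> y - \<sigma> x\<bar> \<le> \<kappa> * \<bar>y - x\<bar>" if "\<bar>y - x\<bar> \<le> 1" for y
  proof -
    have "norm (\<sigma> y - \<sigma> x) \<le> \<kappa> * norm (y - x)"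
      by (rule field_differentiable_bound[where S = "{x - 1..x + 1}" and f' = \<sigma>'])
        (use \<kappa> that d(1) in \<open>auto intro: DERIV_subset\<close>)
    then show ?thesis by simp
  qed
  moreover have "continuous_on UNIV \<sigma>"
    using d(1) by (auto intro!: continuous_at_imp_continuous_on DERIV_isCont)
  ultimately show thesis by (rule that[rotated])
qed

theorem corollary14:
  fixes M :: "'a measure" and F :: "real \<Rightarrow> 'a measure"
    and L X :: "real \<Rightarrow> 'a \<Rightarrow> real"
    and A \<gamma> a v x :: real and \<nu> :: "real measure"
    and f \<sigma> :: "real \<Rightarrow> real"
  assumes "filtered_prob_space M F"
    and "levy_process M F L"
    and "characteristic_triplet M L A \<nu> \<gamma>"
    and "A = 0"
    and "drift_exists \<nu> \<longrightarrow> drift \<nu> \<gamma> = 0"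
    and "continuous_on {0..} f"
    and "mono_on {0..} f"
    and "\<forall>t\<ge>0. f t \<ge> 0"
    and "0 < a" and "a \<le> 1 / 2"
    and "regularly_varying_at_zero a f"
    and "tendsto_in_prob M (\<lambda>t \<omega>. L t \<omega> / f t) (\<lambda>_. v) (at_right 0)"
    and "twice_continuously_differentiable \<sigma>"
    and "at_most_linear_growth \<sigma>"
    and "sde_solution M F \<sigma> L x X"
  shows "tendsto_in_prob M (\<lambda>t \<omega>. (X t \<omega> - x) / f t) (\<lambda>_. \<sigma> x * v) (at_right 0)"
proof -
  interpret filtered_prob_space M F by fact
  obtain K where K: "levy_with_moment_rate M F L K"
    using levy_with_moment_rateI[OF assms(2,3)] by blast
  obtain \<kappa> where "continuous_on UNIV \<sigma>" "\<And>y. \<bar>y - x\<bar> \<le> 1 \<Longrightarrow> \<bar>\<sigma> y - \<sigma> x\<bar> \<le> \<kappa> * \<bar>y - x\<bar>"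
    using twice_continuously_differentiable_locally_lipschitz[OF assms(13), of x] by blast
  with K assms(15) have "levy_sde M F L K \<sigma> x X \<kappa>"
    by (simp add: levy_sde_def levy_sde_axioms_def)
  then interpret levy_sde M F L K \<sigma> x X \<kappa> .
  have "a < 1" using assms(10) by simp
  have f_pos: "eventually (\<lambda>t. 0 < f t) (at_right 0)" and t_f: "((\<lambda>t. t / f t) \<longlongrightarrow> 0) (at_right 0)"
    using regularly_varying_at_zero_dominates_identity[OF assms(7,8,11) \<open>a < 1\<close>] by auto
  define C where "C = 8 * K * exp K * \<kappa>\<^sup>2 * displacement_rate"
  \<comment> \<open>The 1 keeps the tolerance \<open>\<epsilon> / (2 * c)\<close> meaningful when
    \<open>\<sigma> x = 0\<close>.\<close>
  define c where "c = \<bar>\<sigma> x\<bar> + 1"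
  have c: "0 < c" "\<bar>\<sigma> x\<bar> \<le> c" by (auto simp: c_def)
  show ?thesis unfolding tendsto_in_prob_def
  proof (intro allI impI)
    fix \<epsilon> :: real assume \<epsilon>: "0 < \<epsilon>"
    let ?T = "\<lambda>t. {\<omega> \<in> space M. \<epsilon> < \<bar>(X t \<omega> - x) / f t - \<sigma> x * v\<bar>}"
    let ?V = "\<lambda>t. {\<omega> \<in> space M. \<epsilon> / (2 * c) < \<bar>L t \<omega> / f t - v\<bar>}"
    let ?b = "\<lambda>t. prob (escape t) + (2 * K + 1) * t + C * (2 / \<epsilon> * (t / f t))\<^sup>2 + prob (?V t)"
    have "eventually (\<lambda>t::real. 0 < t \<and> t \<le> 1) (at_right 0)"
      by (rule eventually_at_rightI[of 0 1]) auto
    then have le: "eventually (\<lambda>t. prob (?T t) \<le> ?b t) (at_right 0)"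
      using f_pos
    proof eventually_elim
      fix t :: real assume "0 < t \<and> t \<le> 1" and f: "0 < f t"
      then have t: "0 < t" "t \<le> 1" by auto
      have [measurable]: "X t \<in> borel_measurable M" "L t \<in> borel_measurable M" using t by auto
      \<comment> \<open>The threshold for the remainder scales with \<open>f t\<close>, so its bound
        involves only the square of \<open>2 / \<epsilon> * (t / f t)\<close>, which tends to
        0.\<close>
      let ?G = "{\<omega> \<in> space M. \<epsilon> / 2 * f t < \<bar>X t \<omega> - x - \<sigma> x * L t \<omega>\<bar>}"
      have sets: "?G \<in> sets M" "?V t \<in> sets M" by measurable
      have "?T t \<subseteq> ?G \<union> ?V t"
      proof (rule subsetI, rule ccontr)
        fix \<omega> assume T: "\<omega> \<in> ?T t" and no: "\<omega> \<notin> ?G \<union> ?V t"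
        have "\<bar>X t \<omega> - x - \<sigma> x * L t \<omega>\<bar> \<le> \<epsilon> / 2 * f t" using no T by (simp add: not_less)
        then have 1: "\<bar>(X t \<omega> - x - \<sigma> x * L t \<omega>) / f t\<bar> \<le> \<epsilon> / 2"
          using f by (simp add: abs_divide pos_divide_le_eq)
        have "\<bar>L t \<omega> / f t - v\<bar> \<le> \<epsilon> / (2 * c)" using no T by (simp add: not_less)
        then have "\<bar>\<sigma> x\<bar> * \<bar>L t \<omega> / f t - v\<bar> \<le> c * (\<epsilon> / (2 * c))"
          using c by (intro mult_mono) auto
        then have 2: "\<bar>\<sigma> x * (L t \<omega> / f t - v)\<bar> \<le> \<epsilon> / 2" using c by (simp add: abs_mult)
        have "(X t \<omega> - x) / f t - \<sigma> x * v
            = (X t \<omega> - x - \<sigma> x * L t \<omega>) / f t + \<sigma> x * (L t \<omega> / f t - v)"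
          using f by (simp add: field_simps)
        then have "\<bar>(X t \<omega> - x) / f t - \<sigma> x * v\<bar> \<le> \<epsilon>" using 1 2 by linarith
        then show False using T by simp
      qed
      then have "prob (?T t) \<le> prob (?G \<union> ?V t)" by (rule finite_measure_mono) (intro sets.Un sets)
      also have "\<dots> \<le> prob ?G + prob (?V t)" by (intro measure_Un_le sets)
      also have "prob ?G \<le> prob (escape t) + (2 * K + 1) * t + C * (t / (\<epsilon> / 2 * f t))\<^sup>2"
        unfolding C_def by (rule linearization_error[OF t]) (use \<epsilon> f in simp)
      also have "t / (\<epsilon> / 2 * f t) = 2 / \<epsilon> * (t / f t)" by simp
      finally show "prob (?T t) \<le> ?b t" by simp
    qed
    have V: "((\<lambda>t. prob (?V t)) \<longlongrightarrow> 0) (at_right 0)"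
      using assms(12)[unfolded tendsto_in_prob_def, rule_format, of "\<epsilon> / (2 * c)"] \<epsilon> c by simp
    have "(?b \<longlongrightarrow> 0 + (2 * K + 1) * 0 + C * (2 / \<epsilon> * 0)\<^sup>2 + 0) (at_right 0)"
      by (intro tendsto_add prob_escape_tendsto V tendsto_mult tendsto_power tendsto_const tendsto_ident_at t_f)
    then have lim: "(?b \<longlongrightarrow> 0) (at_right 0)" by simp
    show "((\<lambda>t. prob (?T t)) \<longlongrightarrow> 0) (at_right 0)"
      by (rule tendsto_sandwich[OF _ le tendsto_const lim]) simp
  qed
qed

end
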